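(* There is a symmetric probability distribution on $\mathbb{Z}$ such that two independent copies $(S_n)_{n\ge0}$, $(\tilde S_n)_{n\ge0}$ of the associated random walk satisfy the following two conditions. (a) The two-dimensional random walk $(S_n,\tilde S_n)$ is transient. (b) Almost surely the event $$V_n=\{\operatorname{sgn}(S_n)=-\operatorname{sgn}(S_{n+1}),\ \tilde S_n=0=\tilde S_{n+1}\}$$ occurs for infinitely many $n$. In particular, $$\sum_{n=1}^\infty P(S_n=0)^2<\infty\qquad\text{and}\qquad \sum_{n=1}^\infty P(S_n=0)\,P(S_nS_{n+1}<0)=\infty .$$
   Context: The random walk associated with a distribution $\mu$ on $\mathbb{Z}$ is $S_n=X_1+\dots+X_n$, $S_0=0$, with $X_j$ i.i.d. of law $\mu$. The distribution $\mu$ is symmetric if $\mu(\{k\})=\mu(\{-k\})$ for all $k$. Transient has the usual meaning: almost surely the walk visits the origin only finitely often. Here $\operatorname{sgn}(x)=1,0,-1$ according to whether $x>0$, $x=0$, $x<0$. *)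

theory Defs
  imports "HOL-Probability.Probability"
begin

(* A probability distribution on the integers is an int pmf; all subsets of the integers
   are measurable for measure_pmf. *)
definition symmetric_pmf :: "int pmf \<Rightarrow> bool" where
  "symmetric_pmf \<mu> \<longleftrightarrow> (\<forall>k. pmf \<mu> k = pmf \<mu> (- k))"

(* Canonical space of i.i.d. steps: under this measure the coordinates x 0, x 1, ... are
   independent with law \<mu>.  The step X_j, j = 1, 2, ..., is the coordinate x (j - 1). *)
definition step_space :: "int pmf \<Rightarrow> (nat \<Rightarrow> int) measure" where
  "step_space \<mu> = PiM UNIV (\<lambda>_. measure_pmf \<mu>)"

definition walk :: "nat \<Rightarrow> (nat \<Rightarrow> int) \<Rightarrow> int" where
  "walk n x = (\<Sum>j<n. x j)"

(* Step sequences of two independent copies of the walk. *)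
definition step_space2 :: "int pmf \<Rightarrow> ((nat \<Rightarrow> int) \<times> (nat \<Rightarrow> int)) measure" where
  "step_space2 \<mu> = step_space \<mu> \<Otimes>\<^sub>M step_space \<mu>"

definition transient :: "'a measure \<Rightarrow> (nat \<Rightarrow> 'a \<Rightarrow> 'b::zero) \<Rightarrow> bool" where
  "transient M W \<longleftrightarrow> (AE \<omega> in M. finite {n. W n \<omega> = 0})"

end

theory Submission
  imports Defs
begin

text \<open>
  The step law is a mixture of levels \<open>k = 0, 1, 2, \<dots>\<close>. Level \<open>k\<close> or higher occurs with probability
  \<open>1 / Q\<^sub>k\<close>, and a step of level \<open>k\<close> is symmetric, unimodal and spread over an interval of length of
  order \<open>h\<^sub>k\<close>. Here \<open>h\<^sub>k = 4\<^sup>k Q\<^sub>k\<close> while \<open>Q\<^sub>k\<^sub>+\<^sub>1\<close> is exponentially large in \<open>h\<^sub>k\<close>. Between the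
  times \<open>Q\<^sub>k\<close> and \<open>Q\<^sub>k\<^sub>+\<^sub>1\<close> (up to smaller factors) the walk looks like a walk with finite variance, so that
  \<open>P(S\<^sub>n = x)\<close> is of order \<open>1 / (h\<^sub>k \<surd>(n / Q\<^sub>k))\<close> for \<open>x\<close> of order \<open>h\<^sub>k\<close>.

  Summed over this range of times, \<open>P(S\<^sub>n = 0)\<^sup>2\<close> gives about
  \<open>(Q\<^sub>k / h\<^sub>k\<^sup>2) log (Q\<^sub>k\<^sub>+\<^sub>1 / Q\<^sub>k)\<close>, which is of order \<open>Q\<^sub>k / h\<^sub>k = 4\<^sup>-\<^sup>k\<close>. These numbers are summable, and
  transience follows by the Borel--Cantelli lemma (lemmas \<open>summable_hit_square\<close> and \<open>AE_origin_finite\<close>).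
  The sign changes over a return of the other walk are more frequent by a factor \<open>h\<^sub>k / Q\<^sub>k\<close>, since
  a step of level \<open>k\<close> crosses the origin from any of about \<open>h\<^sub>k\<close> positions; their expected number in the
  range is bounded below by a constant. A second moment bound shows that with probability at least
  \<open>c > 0\<close>, uniformly in all starting points within distance \<open>h\<^sub>k\<close> of the origin, such an event does occur
  in the range (lemma \<open>prob_crossing_block\<close>).

  Consequently the supremum \<open>H\<close> over all starting points of the probability that no crossing ever occurs
  satisfies \<open>H \<le> (1 - c) H\<close> by the Markov property, hence \<open>H = 0\<close>, and crossings occur infinitely often
  (lemmas \<open>never_zero\<close> and \<open>AE_crossing_infinite\<close>). If the last series converged, the Borel--Cantelli
  lemma together with transience would contradict this.

  The upper bound on \<open>P(S\<^sub>n = x)\<close> is elementary (lemma \<open>hit_upper\<close>): a step of level \<open>k\<close> is a uniform variable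
  on a complete residue system modulo \<open>m = 2 h\<^sub>k + 1\<close> plus \<open>m\<close> times a difference of two fair coin
  flips. After \<open>j\<close> such steps the residue contributes \<open>1 / m\<close> and the coins a central binomial probability of order
  \<open>1 / \<surd>j\<close>. The lower bound (lemma \<open>hit_lower\<close>) needs no local limit theorem either: the law of \<open>S\<^sub>n\<close> is symmetric and
  unimodal, so Chebyshev's inequality for truncated steps and the upper bound at \<open>0\<close> force it to have
  mass of the right order at every point of order \<open>h\<^sub>k\<close>.
\<close>

section \<open>Averaging operators of integer distributions\<close>

text \<open>The transition operator of the walk with step law \<open>\<mu>\<close>, acting on functions: \<open>avg \<mu> f x\<close> is the
  expectation of \<open>f (x + X)\<close> for a step \<open>X\<close>.\<close>

definition avg :: "int pmf \<Rightarrow> (int \<Rightarrow> real) \<Rightarrow> int \<Rightarrow> real" where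
  "avg \<mu> f x = measure_pmf.expectation \<mu> (\<lambda>y. f (x + y))"

text \<open>Functions with values between \<open>0\<close> and \<open>B\<close>, which are integrable for every step law.\<close>

definition bounded_by :: "real \<Rightarrow> (int \<Rightarrow> real) \<Rightarrow> bool" where
  "bounded_by B f \<longleftrightarrow> (\<forall>x. 0 \<le> f x \<and> f x \<le> B)"

lemma integrable_bounded_by:
  fixes f :: "'a \<Rightarrow> real"
  assumes "\<And>y. 0 \<le> f y" "\<And>y. f y \<le> B"
  shows "integrable (measure_pmf \<mu>) f"
  by (rule measure_pmf.integrable_const_bound[where B = B]) (use assms in auto)

lemma avg_integrable: "bounded_by B f \<Longrightarrow> integrable (measure_pmf \<mu>) (\<lambda>y. f (x + y))"
  by (rule integrable_bounded_by[where B = B]) (auto simp: bounded_by_def)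

lemma avg_mono:
  assumes "bounded_by B f" "bounded_by C g" "\<And>y. f y \<le> g y"
  shows "avg \<mu> f x \<le> avg \<mu> g x"
  unfolding avg_def by (intro integral_mono avg_integrable[OF assms(1)] avg_integrable[OF assms(2)] assms(3))

lemma avg_bounds:
  assumes "\<And>x. 0 \<le> f x" "\<And>x. f x \<le> B"
  shows "0 \<le> avg \<mu> f x" "avg \<mu> f x \<le> B"
proof -
  show "0 \<le> avg \<mu> f x"
    unfolding avg_def by (intro Bochner_Integration.integral_nonneg) (use assms in auto)
  have "avg \<mu> f x \<le> avg \<mu> (\<lambda>_. B) x"
    using order_trans[OF assms(1)[of 0] assms(2)[of 0]]
    by (intro avg_mono[of B _ B]) (use assms in \<open>auto simp: bounded_by_def\<close>)
  then show "avg \<mu> f x \<le> B"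
    by (simp add: avg_def)
qed

lemma bounded_by_avg: "bounded_by B f \<Longrightarrow> bounded_by B (avg \<mu> f)"
  using avg_bounds[of f B \<mu>] by (auto simp: bounded_by_def)

lemma bounded_by_avg_pow: "bounded_by B f \<Longrightarrow> bounded_by B ((avg \<mu> ^^ n) f)"
  by (induction n) (auto intro: bounded_by_avg)

lemma expectation_bind_pmf:
  fixes f :: "'b \<Rightarrow> real"
  assumes f: "\<And>y. 0 \<le> f y" "\<And>y. f y \<le> B"
  shows "measure_pmf.expectation (bind_pmf l K) f =
    measure_pmf.expectation l (\<lambda>j. measure_pmf.expectation (K j) f)"
proof -
  have E: "ennreal (measure_pmf.expectation M g) = (\<integral>\<^sup>+x. g x \<partial>measure_pmf M)"
    if "\<And>y. 0 \<le> g y" "\<And>y. g y \<le> B" for M :: "'c pmf" and g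
    by (rule nn_integral_eq_integral[symmetric]) (use that in \<open>auto intro: integrable_bounded_by\<close>)
  have b: "0 \<le> measure_pmf.expectation (K j) f" "measure_pmf.expectation (K j) f \<le> B" for j
    using f by (auto intro!: Bochner_Integration.integral_nonneg measure_pmf.integral_le_const integrable_bounded_by)
  have "ennreal (measure_pmf.expectation (bind_pmf l K) f) =
      (\<integral>\<^sup>+j. (\<integral>\<^sup>+x. f x \<partial>measure_pmf (K j)) \<partial>measure_pmf l)"
    using nn_integral_eq_integral[of "measure_pmf (bind_pmf l K)" f] f
    by (simp add: integrable_bounded_by[where B = B])
  also have "\<dots> = (\<integral>\<^sup>+j. ennreal (measure_pmf.expectation (K j) f) \<partial>measure_pmf l)"
    by (intro nn_integral_cong)
      (simp add: nn_integral_eq_integral f integrable_bounded_by[where B = B])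
  also have "\<dots> = ennreal (measure_pmf.expectation l (\<lambda>j. measure_pmf.expectation (K j) f))"
    by (rule nn_integral_eq_integral) (use b in \<open>auto intro: integrable_bounded_by\<close>)
  finally show ?thesis
    by (subst (asm) ennreal_inj) (use f b in \<open>auto intro!: Bochner_Integration.integral_nonneg\<close>)
qed

section \<open>The elementary steps\<close>

text \<open>The averaging operator of the uniform law on \<open>{- h..h}\<close>, an interval which is a complete residue system
  modulo \<open>2 h + 1\<close>.\<close>

definition unif_avg :: "nat \<Rightarrow> (int \<Rightarrow> real) \<Rightarrow> int \<Rightarrow> real" where
  "unif_avg h f x = (\<Sum>u\<in>{- int h..int h}. f (x + u)) / real (2 * h + 1)"

text \<open>The averaging operator of \<open>m\<close> times the difference of two fair coin flips.\<close>

definition coin_avg :: "int \<Rightarrow> (int \<Rightarrow> real) \<Rightarrow> int \<Rightarrow> real" where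
  "coin_avg m f x = (f (x - m) + 2 * f x + f (x + m)) / 4"

text \<open>The elementary step of width \<open>h\<close>: a uniform variable on \<open>{- h..h}\<close> plus \<open>2 h + 1\<close> times an independent
  difference of two coin flips. It is symmetric and unimodal with values of modulus at most \<open>3 h + 1\<close>.\<close>

definition block_step :: "nat \<Rightarrow> int pmf" where
  "block_step h = map_pmf (\<lambda>(u, c, d). u + (2 * int h + 1) * (of_bool c - of_bool d))
     (pmf_of_set ({- int h..int h} \<times> (UNIV :: (bool \<times> bool) set)))"

lemma avg_block_step: "avg (block_step h) f = unif_avg h (coin_avg (2 * int h + 1) f)"
proof
  fix x
  let ?m = "2 * int h + 1"
  have "avg (block_step h) f x =
    (\<Sum>(u, c, d)\<in>{- int h..int h} \<times> (UNIV :: (bool \<times> bool) set).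
       f (x + (u + ?m * (of_bool c - of_bool d)))) / real (4 * (2 * h + 1))"
    unfolding avg_def block_step_def
    by (simp add: integral_pmf_of_set card_cartesian_product case_prod_beta' card_UNIV_bool
        flip: UNIV_Times_UNIV)
  also have "\<dots> = (\<Sum>u\<in>{- int h..int h}. \<Sum>(c, d)\<in>UNIV.
       f (x + (u + ?m * (of_bool c - of_bool d)))) / real (4 * (2 * h + 1))"
    by (simp add: sum.cartesian_product case_prod_beta')
  also have "\<dots> = (\<Sum>u\<in>{- int h..int h}. 4 * coin_avg ?m f (x + u)) / real (4 * (2 * h + 1))"
    unfolding coin_avg_def
    by (intro arg_cong2[where f = "(/)"] sum.cong refl)
      (simp add: UNIV_bool algebra_simps flip: UNIV_Times_UNIV sum.cartesian_product)
  also have "\<dots> = unif_avg h (coin_avg ?m f) x"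
    by (simp add: unif_avg_def field_simps flip: sum_distrib_left)
  finally show "avg (block_step h) f x = unif_avg h (coin_avg ?m f) x" .
qed

lemma unif_avg_mono: "(\<And>y. f y \<le> g y) \<Longrightarrow> unif_avg h f x \<le> unif_avg h g x"
  by (auto simp: unif_avg_def intro!: divide_right_mono sum_mono)

lemma unif_avg_const: "unif_avg h (\<lambda>_. c) = (\<lambda>_. c)"
  by (auto simp: unif_avg_def fun_eq_iff nat_add_distrib nat_mult_distrib field_simps)

lemma unif_avg_coin_avg: "unif_avg h (coin_avg m f) = coin_avg m (unif_avg h f)"
proof
  fix x
  define d where "d = real (2 * h + 1)"
  have "unif_avg h (coin_avg m f) x =
      (\<Sum>u\<in>{- int h..int h}. f (x - m + u) + 2 * f (x + u) + f (x + m + u)) / 4 / d"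
    unfolding unif_avg_def coin_avg_def sum_divide_distrib[symmetric] d_def by (simp add: algebra_simps)
  also have "\<dots> = coin_avg m (unif_avg h f) x"
    unfolding coin_avg_def unif_avg_def sum.distrib d_def[symmetric]
    by (simp add: add_divide_distrib flip: sum_distrib_left)
  finally show "unif_avg h (coin_avg m f) x = coin_avg m (unif_avg h f) x" .
qed

lemma avg_coin_unif:
  assumes "bounded_by B f"
  shows "avg \<mu> (unif_avg h f) = unif_avg h (avg \<mu> f)" (is ?A)
    and "avg \<mu> (coin_avg m f) = coin_avg m (avg \<mu> f)" (is ?B)
proof -
  have I: "integrable (measure_pmf \<mu>) (\<lambda>y. f (x + y))" for x
    by (rule avg_integrable[OF assms])
  have I2: "integrable (measure_pmf \<mu>) (\<lambda>y. f (x + y + z))" for x z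
    using I[of "x + z"] by (simp add: algebra_simps)
  show ?A
  proof
    fix x
    have "avg \<mu> (unif_avg h f) x = measure_pmf.expectation \<mu> (\<lambda>y. \<Sum>u\<in>{- int h..int h}. f (x + y + u)) / real (2 * h + 1)"
      by (simp add: avg_def unif_avg_def)
    also have "\<dots> = (\<Sum>u\<in>{- int h..int h}. measure_pmf.expectation \<mu> (\<lambda>y. f (x + y + u))) / real (2 * h + 1)"
      by (subst Bochner_Integration.integral_sum) (use I2 in auto)
    also have "\<dots> = unif_avg h (avg \<mu> f) x"
      by (simp add: avg_def unif_avg_def algebra_simps)
    finally show "avg \<mu> (unif_avg h f) x = unif_avg h (avg \<mu> f) x" .
  qed
  have I3: "integrable (measure_pmf \<mu>) (\<lambda>y. f (x + y - m))" for x
    using I[of "x - m"] by (simp add: algebra_simps)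
  show ?B
    by (simp add: fun_eq_iff avg_def coin_avg_def I I2 I3)
      (simp add: algebra_simps)
qed

text \<open>The probability that \<open>j\<close> differences of two fair coin flips add up to \<open>b\<close>. It is written with
  \<open>\<bar>b\<bar>\<close> so that the index of the binomial coefficient is a natural number.\<close>

definition coin_sum_prob :: "nat \<Rightarrow> int \<Rightarrow> real" where
  "coin_sum_prob j b = real ((2 * j) choose (j + nat \<bar>b\<bar>)) / 4 ^ j"

lemma coin_sum_prob_Suc:
  "coin_sum_prob (Suc j) b =
    (coin_sum_prob j (b - 1) + 2 * coin_sum_prob j b + coin_sum_prob j (b + 1)) / 4"
proof -
  have pascal: "(2 * Suc j) choose (Suc j + a) =
      ((2 * j) choose (j + a - 1)) + 2 * ((2 * j) choose (j + a)) + ((2 * j) choose (j + a + 1))"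
    if a1: "a \<ge> 1" for a
  proof -
    obtain a' where "a = Suc a'" using a1 by (cases a) auto
    then show ?thesis by simp
  qed
  have pascal0: "(2 * Suc j) choose (Suc j) = 2 * ((2 * j) choose j) + 2 * ((2 * j) choose (j + 1))"
  proof -
    have "(2 * j + 1) choose j = (2 * j + 1) choose (j + 1)"
      using binomial_symmetric[of j "2 * j + 1"] by simp
    then show ?thesis by simp
  qed
  consider "b = 0" | "b \<ge> 1" | "b \<le> -1" by linarith
  then show ?thesis
  proof cases
    case 1
    then show ?thesis using pascal0
      by (simp add: coin_sum_prob_def field_simps)
  next
    case 2
    define a where "a = nat b"
    have n: "nat \<bar>b\<bar> = a" "nat \<bar>b - 1\<bar> = a - 1" "nat \<bar>b + 1\<bar> = a + 1" "a \<ge> 1"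
      using 2 by (auto simp: a_def)
    show ?thesis
      unfolding coin_sum_prob_def n pascal[OF n(4)] using n(4) by (simp add: field_simps)
  next
    case 3
    define a where "a = nat (-b)"
    have n: "nat \<bar>b\<bar> = a" "nat \<bar>b - 1\<bar> = a + 1" "nat \<bar>b + 1\<bar> = a - 1" "a \<ge> 1"
      using 3 by (auto simp: a_def)
    show ?thesis
      unfolding coin_sum_prob_def n pascal[OF n(4)] using n(4) by (simp add: field_simps)
  qed
qed

lemma central_binomial_upper: "coin_sum_prob j 0 \<le> 1 / sqrt (2 * real j + 1)"
proof -
  have "(coin_sum_prob j 0)\<^sup>2 * (2 * real j + 1) \<le> 1"
  proof (induction j)
    case 0
    then show ?case by (simp add: coin_sum_prob_def)
  next
    case (Suc j)
    let ?c = "coin_sum_prob j 0"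
    have "Suc j * ((2 * Suc j) choose Suc j) = 2 * (2 * j + 1) * ((2 * j) choose j)"
    proof -
      have 1: "Suc j * ((2 * Suc j) choose Suc j) = (2 * j + 2) * ((2 * j + 1) choose j)"
        using Suc_times_binomial_eq[of "2 * j + 1" j] by simp
      have 2: "(2 * j + 1) choose j = (2 * j + 1) choose Suc j"
        using binomial_symmetric[of j "2 * j + 1"] by simp
      have 3: "Suc j * ((2 * j + 1) choose Suc j) = (2 * j + 1) * ((2 * j) choose j)"
        using Suc_times_binomial_eq[of "2 * j" j] by simp
      have "Suc j * ((2 * Suc j) choose Suc j) = 2 * (Suc j * ((2 * j + 1) choose Suc j))"
        using 1 2 by simp
      then show ?thesis using 3 by simp
    qed
    then have "real (Suc j) * real ((2 * Suc j) choose Suc j) =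
        2 * (2 * real j + 1) * real ((2 * j) choose j)"
      by (metis (mono_tags, lifting) of_nat_mult of_nat_add of_nat_numeral of_nat_1)
    then have "real ((2 * Suc j) choose Suc j) =
        2 * (2 * real j + 1) / real (Suc j) * real ((2 * j) choose j)"
      by (metis nonzero_mult_div_cancel_left of_nat_eq_0_iff nat.distinct(1) times_divide_eq_left)
    then have e: "coin_sum_prob (Suc j) 0 = (2 * real j + 1) / (2 * real j + 2) * ?c"
      unfolding coin_sum_prob_def
      by (simp add: divide_simps del: binomial_Suc_Suc) (simp add: algebra_simps del: binomial_Suc_Suc)
    have "(coin_sum_prob (Suc j) 0)\<^sup>2 * (2 * real (Suc j) + 1) =
        (?c\<^sup>2 * (2 * real j + 1)) * ((2 * real j + 1) * (2 * real j + 3) / (2 * real j + 2)\<^sup>2)"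
      unfolding e by (simp add: power_mult_distrib power_divide power2_eq_square)
    also have "\<dots> \<le> 1 * 1"
    proof (intro mult_mono Suc)
      have "(2 * real j + 1) * (2 * real j + 3) \<le> (2 * real j + 2)\<^sup>2"
        by (simp add: power2_eq_square algebra_simps)
      then show "(2 * real j + 1) * (2 * real j + 3) / (2 * real j + 2)\<^sup>2 \<le> 1"
        by (intro divide_le_eq_1_pos[THEN iffD2]) auto
    qed auto
    finally show ?case by simp
  qed
  then have "(coin_sum_prob j 0)\<^sup>2 \<le> (1 / sqrt (2 * real j + 1))\<^sup>2"
    by (simp add: power_divide field_simps)
  then show ?thesis
    by (rule power2_le_imp_le) simp
qed

lemma coin_sum_prob_le: "coin_sum_prob j b \<le> 1 / sqrt (2 * real j + 1)"
proof -
  have "((2 * j) choose (j + nat \<bar>b\<bar>)) \<le> ((2 * j) choose j)"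
    by (rule binomial_maximum')
  then have "coin_sum_prob j b \<le> coin_sum_prob j 0"
    unfolding coin_sum_prob_def by (intro divide_right_mono) auto
  then show ?thesis using central_binomial_upper[of j] by linarith
qed

text \<open>The indicator function of the origin.\<close>

abbreviation point0 :: "int \<Rightarrow> real" where "point0 \<equiv> \<lambda>x. of_bool (x = 0)"

lemma coin_avg_pow:
  assumes m: "m > 0"
  shows "(coin_avg m ^^ j) point0 x = (if m dvd x then coin_sum_prob j (x div m) else 0)"
proof (induction j arbitrary: x)
  case 0
  show ?case
  proof (cases "m dvd x")
    case True
    then obtain b where "x = m * b" by auto
    then show ?thesis using m by (auto simp: coin_sum_prob_def)
  next
    case False
    then show ?thesis by auto
  qed
next
  case (Suc j)
  show ?case
  proof (cases "m dvd x")
    case True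
    then obtain b where b: "x = m * b" by auto
    have 1: "x - m = m * (b - 1)" "x + m = m * (b + 1)" by (auto simp: b algebra_simps)
    show ?thesis using m
      unfolding funpow.simps o_apply
      by (subst coin_avg_def, unfold Suc 1) (simp add: b coin_sum_prob_Suc)
  next
    case False
    then have "\<not> m dvd x - m" "\<not> m dvd x + m"
      by (simp_all add: dvd_diff_left_iff dvd_add_left_iff)
    then show ?thesis using False
      unfolding funpow.simps o_apply
      by (subst coin_avg_def, unfold Suc) simp
  qed
qed

text \<open>A uniform variable on a complete residue system lies in any given residue class with probability
  \<open>1 / (2 h + 1)\<close>.\<close>

lemma unif_avg_dvd: "unif_avg h (\<lambda>x. of_bool ((2 * int h + 1) dvd x)) x = 1 / real (2 * h + 1)"
proof -
  let ?m = "2 * int h + 1"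
  define u0 where "u0 = (h + x) mod ?m"
  have u0: "0 \<le> u0" "u0 < ?m"
    unfolding u0_def by (simp, rule pos_mod_bound) simp
  have "?m dvd (h + x) - u0" unfolding u0_def by (rule dvd_minus_mod)
  then have d: "?m dvd x + (h - u0)"
    by (simp add: algebra_simps)
  have "{u \<in> {- int h..int h}. ?m dvd x + u} = {int h - u0}"
  proof safe
    fix u assume u: "u \<in> {- int h..int h}" "?m dvd x + u"
    have "?m dvd (x + u) - (x + (h - u0))" using u(2) d by (rule dvd_diff)
    then have "?m dvd u - (h - u0)" by simp
    moreover have "\<bar>u - (h - u0)\<bar> < ?m" using u u0 by auto
    ultimately show "u = h - u0" using dvd_imp_le_int[of "u - (h - u0)" ?m] by linarith
  next
    show "int h - u0 \<in> {- int h..int h}" using u0 by auto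
    show "?m dvd x + (int h - u0)" by (rule d)
  qed
  then have "card {u \<in> {- int h..int h}. ?m dvd x + u} = 1" by simp
  moreover have "(\<Sum>u\<in>{- int h..int h}. of_bool (?m dvd x + u) :: real) = card {u \<in> {- int h..int h}. ?m dvd x + u}"
    by (simp add: of_bool_def sum.If_cases Int_def conj_commute)
  ultimately show ?thesis by (simp add: unif_avg_def)
qed

text \<open>Concentration of a sum of \<open>j\<close> elementary steps. The uniform and the coin operators commute, so the coin
  flips may be averaged first; they give a function supported on the multiples of \<open>2 h + 1\<close>, and one uniform
  average turns the indicator of these multiples into the constant \<open>1 / (2 h + 1)\<close>.\<close>

lemma block_step_pow_le:
  assumes "j \<ge> 1"
  shows "(avg (block_step h) ^^ j) point0 x \<le> 1 / (real (2 * h + 1) * sqrt (real j + 1))"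
proof -
  let ?m = "2 * int h + 1"
  have 1: "(unif_avg h ^^ i) (coin_avg ?m f) = coin_avg ?m ((unif_avg h ^^ i) f)" for i f
    by (induction i) (simp_all add: unif_avg_coin_avg)
  have "(avg (block_step h) ^^ j) f = (unif_avg h ^^ j) ((coin_avg ?m ^^ j) f)" for f
  proof (induction j)
    case (Suc i)
    then show ?case by (simp add: avg_block_step 1)
  qed simp
  moreover obtain i where i: "j = Suc i" using assms by (cases j) auto
  have "coin_sum_prob j b \<le> 1 / sqrt (real j + 1)" for b
    using coin_sum_prob_le[of j b] by (rule order_trans) (simp add: field_simps)
  then have c: "(coin_avg ?m ^^ j) point0 y \<le> 1 / sqrt (real j + 1) * of_bool (?m dvd y)" for y
    by (simp add: coin_avg_pow)
  have u: "unif_avg h ((coin_avg ?m ^^ j) point0) y \<le> 1 / (real (2 * h + 1) * sqrt (real j + 1))" for y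
  proof -
    have "unif_avg h ((coin_avg ?m ^^ j) point0) y \<le>
        unif_avg h (\<lambda>y. 1 / sqrt (real j + 1) * of_bool (?m dvd y)) y"
      by (rule unif_avg_mono) (rule c)
    also have "\<dots> = 1 / sqrt (real j + 1) * unif_avg h (\<lambda>y. of_bool (?m dvd y)) y"
      unfolding unif_avg_def times_divide_eq_right sum_distrib_left ..
    finally show ?thesis unfolding unif_avg_dvd by (simp add: mult.commute)
  qed
  have "(unif_avg h ^^ i) (unif_avg h ((coin_avg ?m ^^ j) point0)) y \<le>
      1 / (real (2 * h + 1) * sqrt (real j + 1))" for y
  proof (induction i arbitrary: y)
    case 0
    then show ?case using u by simp
  next
    case (Suc i)
    then show ?case
      using unif_avg_mono[of _ "\<lambda>_. 1 / (real (2 * h + 1) * sqrt (real j + 1))" h y, OF Suc]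
      by (simp add: unif_avg_const)
  qed
  ultimately show ?thesis
    by (simp add: i funpow_swap1)
qed

section \<open>Concentration\<close>

text \<open>\<open>hit \<mu> n x\<close> is the probability that the walk started at \<open>x\<close> is at the origin at time \<open>n\<close> (see
  \<open>prob_walk\<close> below).\<close>

abbreviation hit :: "int pmf \<Rightarrow> nat \<Rightarrow> int \<Rightarrow> real" where
  "hit \<mu> n \<equiv> (avg \<mu> ^^ n) point0"

lemma bounded_by_point0: "bounded_by 1 point0"
  by (simp add: bounded_by_def)

lemma bounded_by_hit: "bounded_by 1 (hit \<mu> n)"
  by (rule bounded_by_avg_pow[OF bounded_by_point0])

lemma avg_linear:
  assumes "bounded_by B f" "bounded_by C g"
  shows "avg \<mu> (\<lambda>x. f x - c * g x) x = avg \<mu> f x - c * avg \<mu> g x"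
  unfolding avg_def using avg_integrable[OF assms(1)] avg_integrable[OF assms(2)] by simp

text \<open>If \<open>\<mu>\<close> dominates \<open>p \<kappa>\<close> pointwise, then \<open>\<kappa>\<close> is a component of \<open>\<mu>\<close> of weight \<open>p\<close>.\<close>

lemma avg_dominated:
  assumes p: "\<And>y. p * pmf \<kappa> y \<le> pmf \<mu> y" "0 \<le> p" and f: "bounded_by B f"
  shows "p * avg \<kappa> f x \<le> avg \<mu> f x"
proof -
  have "ennreal (p * avg \<kappa> f x) = p * (\<integral>\<^sup>+y. f (x + y) \<partial>measure_pmf \<kappa>)"
    using f avg_integrable[OF f] p
    by (simp add: avg_def ennreal_mult'' nn_integral_eq_integral bounded_by_def ennreal_mult' )
  also have "\<dots> = (\<integral>\<^sup>+y. ennreal (p * pmf \<kappa> y) * f (x + y) \<partial>count_space UNIV)"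
    using p(2) by (simp add: nn_integral_measure_pmf nn_integral_cmult[symmetric] ennreal_mult' mult.assoc)
  also have "\<dots> \<le> (\<integral>\<^sup>+y. ennreal (pmf \<mu> y) * f (x + y) \<partial>count_space UNIV)"
    by (intro nn_integral_mono mult_right_mono ennreal_leI p) auto
  also have "\<dots> = ennreal (avg \<mu> f x)"
    using f avg_integrable[OF f]
    by (simp add: avg_def nn_integral_eq_integral bounded_by_def flip: nn_integral_measure_pmf)
  finally show ?thesis
    using bounded_by_avg[OF f, of \<mu>] by (simp add: bounded_by_def)
qed

text \<open>The complementary component \<open>\<mu> - p \<kappa>\<close> has total mass \<open>1 - p\<close>.\<close>

lemma avg_remainder_le:
  assumes p: "\<And>y. p * pmf \<kappa> y \<le> pmf \<mu> y" "0 \<le> p" and f: "\<And>x. 0 \<le> f x" "\<And>x. f x \<le> c"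
  shows "avg \<mu> f x - p * avg \<kappa> f x \<le> (1 - p) * c"
proof -
  have c: "bounded_by c (\<lambda>_. c)" "bounded_by c f" and b: "bounded_by c (\<lambda>x. c - f x)"
    using f order_trans[OF f(1)[of 0] f(2)[of 0]] by (auto simp: bounded_by_def)
  have *: "avg \<nu> (\<lambda>x. c - f x) x = c - avg \<nu> f x" for \<nu>
    using avg_linear[OF c, of \<nu> 1 x] by (simp add: avg_def)
  show ?thesis
    using avg_dominated[OF p b, of x] unfolding * by (simp add: algebra_simps)
qed

lemma avg_pow_comm_block:
  assumes f: "bounded_by B f"
  shows "(avg \<mu> ^^ n) (avg (block_step h) f) = avg (block_step h) ((avg \<mu> ^^ n) f)"
proof (induction n)
  case (Suc n)
  have c: "bounded_by B (coin_avg m g)" if g: "bounded_by B g" for m g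
  proof -
    have bb: "0 \<le> g (x - m)" "g (x - m) \<le> B" "0 \<le> g x" "g x \<le> B" "0 \<le> g (x + m)" "g (x + m) \<le> B" for x
      using g by (auto simp: bounded_by_def)
    have "0 \<le> coin_avg m g x \<and> coin_avg m g x \<le> B" for x
      using bb[of x] unfolding coin_avg_def by simp
    then show ?thesis unfolding bounded_by_def by blast
  qed
  have "(avg \<mu> ^^ Suc n) (avg (block_step h) f) = avg \<mu> (avg (block_step h) ((avg \<mu> ^^ n) f))"
    by (simp add: Suc)
  also have "\<dots> = avg (block_step h) (avg \<mu> ((avg \<mu> ^^ n) f))"
    using bounded_by_avg_pow[OF f, of n \<mu>]
    by (simp add: avg_block_step avg_coin_unif(1)[OF c] avg_coin_unif(2))
  finally show ?case by simp
qed simp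

text \<open>The probability that exactly \<open>j\<close> of \<open>n\<close> steps come from the component of weight \<open>p\<close>.\<close>

definition binomial_weight :: "real \<Rightarrow> nat \<Rightarrow> nat \<Rightarrow> real" where
  "binomial_weight p n j = real (n choose j) * p ^ j * (1 - p) ^ (n - j)"

lemma binomial_weight_sum_Suc:
  "(\<Sum>j\<le>Suc n. binomial_weight p (Suc n) j * g j) =
    (1 - p) * (\<Sum>j\<le>n. binomial_weight p n j * g j) + p * (\<Sum>j\<le>n. binomial_weight p n j * g (Suc j))"
proof -
  have e: "binomial_weight p (Suc n) (Suc j) = p * binomial_weight p n j + (if Suc j \<le> n then (1 - p) * binomial_weight p n (Suc j) else 0)"
    if j: "j \<le> n" for j
  proof (cases "j = n")
    case False
    then have "Suc j \<le> n" "n - j = Suc (n - Suc j)" using j by auto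
    then show ?thesis by (simp add: binomial_weight_def algebra_simps)
  qed (simp add: binomial_weight_def)
  have "(\<Sum>j\<le>Suc n. binomial_weight p (Suc n) j * g j) = binomial_weight p (Suc n) 0 * g 0 + (\<Sum>j\<le>n. binomial_weight p (Suc n) (Suc j) * g (Suc j))"
    by (rule sum.atMost_Suc_shift)
  also have "(\<Sum>j\<le>n. binomial_weight p (Suc n) (Suc j) * g (Suc j)) =
      (\<Sum>j\<le>n. p * (binomial_weight p n j * g (Suc j)) + (if Suc j \<le> n then (1 - p) * (binomial_weight p n (Suc j) * g (Suc j)) else 0))"
    by (intro sum.cong refl) (simp add: e algebra_simps)
  also have "\<dots> = p * (\<Sum>j\<le>n. binomial_weight p n j * g (Suc j)) + (\<Sum>j<n. (1 - p) * (binomial_weight p n (Suc j) * g (Suc j)))"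
  proof -
    have "(\<Sum>j\<le>n. if Suc j \<le> n then G j else 0) = (\<Sum>j<n. G j)" for G :: "nat \<Rightarrow> real"
      by (rule sum.mono_neutral_cong_right) auto
    then show ?thesis by (simp only: sum.distrib sum_distrib_left)
  qed
  also have "binomial_weight p (Suc n) 0 = (1 - p) * binomial_weight p n 0"
    by (simp add: binomial_weight_def)
  finally have "(\<Sum>j\<le>Suc n. binomial_weight p (Suc n) j * g j) =
      (1 - p) * (binomial_weight p n 0 * g 0) + (p * (\<Sum>j\<le>n. binomial_weight p n j * g (Suc j)) +
        (1 - p) * (\<Sum>j<n. binomial_weight p n (Suc j) * g (Suc j)))"
    by (simp only: sum_distrib_left mult.assoc)
  then show ?thesis
    unfolding sum.atMost_shift[of "\<lambda>j. binomial_weight p n j * g j" n] by (simp only: distrib_left add_ac)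
qed

lemma binomial_weight_nonneg: "0 \<le> p \<Longrightarrow> p \<le> 1 \<Longrightarrow> 0 \<le> binomial_weight p n j"
  by (simp add: binomial_weight_def)

lemma binomial_weight_total: "(\<Sum>j\<le>n. binomial_weight p n j) = 1"
  using binomial_ring[of p "1 - p" n] by (simp add: binomial_weight_def)

text \<open>The expectation of \<open>1 / (J + 1)\<close> for a binomial variable \<open>J\<close>; since
  \<open>(n + 1) (n choose j) = (j + 1) (Suc n choose Suc j)\<close>, it is a partial sum of binomial weights of order \<open>n + 1\<close>.\<close>

lemma binomial_weight_harmonic:
  assumes p: "0 < p" "p \<le> 1"
  shows "(\<Sum>j\<le>n. binomial_weight p n j / (real j + 1)) \<le> 1 / ((real n + 1) * p)"
proof -
  have "(real n + 1) * p * (\<Sum>j\<le>n. binomial_weight p n j / (real j + 1)) = (\<Sum>j\<le>n. binomial_weight p (Suc n) (Suc j))"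
    unfolding sum_distrib_left
  proof (intro sum.cong refl)
    fix j
    have "real (Suc n) * real (n choose j) = real (Suc n choose Suc j) * real (Suc j)"
      using arg_cong[OF Suc_times_binomial_eq[of n j], of real] by (simp only: of_nat_mult)
    then have "(real n + 1) * real (n choose j) = real (Suc n choose Suc j) * (real j + 1)"
      by (simp only: of_nat_Suc add.commute[of 1])
    moreover have "real j + 1 \<noteq> 0" by simp
    ultimately have "real (Suc n choose Suc j) = (real n + 1) * real (n choose j) / (real j + 1)"
      by (metis nonzero_mult_div_cancel_right)
    then show "(real n + 1) * p * (binomial_weight p n j / (real j + 1)) = binomial_weight p (Suc n) (Suc j)"
      by (simp add: binomial_weight_def del: binomial_Suc_Suc)
  qed
  also have "\<dots> \<le> (\<Sum>j\<le>Suc n. binomial_weight p (Suc n) j)"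
    unfolding sum.atMost_Suc_shift[of "binomial_weight p (Suc n)"] using binomial_weight_nonneg[of p "Suc n" 0] p by simp
  also have "\<dots> = 1" by (rule binomial_weight_total)
  finally show ?thesis using p by (subst pos_le_divide_eq) (auto simp: mult.commute)
qed

lemma binomial_weight_sqrt:
  assumes p: "0 < p" "p \<le> 1"
  shows "(\<Sum>j\<le>n. binomial_weight p n j / sqrt (real j + 1)) \<le> 1 / sqrt ((real n + 1) * p)"
proof -
  have nn: "0 \<le> binomial_weight p n j" for j using binomial_weight_nonneg p by simp
  have "(\<Sum>j\<le>n. binomial_weight p n j / sqrt (real j + 1)) =
      (\<Sum>j\<le>n. sqrt (binomial_weight p n j) * sqrt (binomial_weight p n j / (real j + 1)))"
    using nn by (intro sum.cong refl) (simp add: real_sqrt_divide)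
  then have "(\<Sum>j\<le>n. binomial_weight p n j / sqrt (real j + 1))\<^sup>2 \<le>
      (\<Sum>j\<le>n. (sqrt (binomial_weight p n j))\<^sup>2) * (\<Sum>j\<le>n. (sqrt (binomial_weight p n j / (real j + 1)))\<^sup>2)"
    using Cauchy_Schwarz_ineq_sum[of "\<lambda>j. sqrt (binomial_weight p n j)" "\<lambda>j. sqrt (binomial_weight p n j / (real j + 1))" "{..n}"]
    by simp
  also have "\<dots> = (\<Sum>j\<le>n. binomial_weight p n j / (real j + 1))"
    using nn by (simp add: binomial_weight_total)
  also have "\<dots> \<le> (1 / sqrt ((real n + 1) * p))\<^sup>2"
    using binomial_weight_harmonic[OF p] p by (simp add: power_divide)
  finally show ?thesis
    by (rule power2_le_imp_le) (use p in simp)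
qed

text \<open>The concentration bound for a walk whose steps contain an elementary step of width \<open>h\<close> with weight \<open>p\<close>.
  The first term accounts for the event that no such step has been made. The other steps enter
  only through their total weight: the induction bounds \<open>n\<close> general steps after \<open>i\<close> elementary ones, and replacing one
  general step by its two components either drops it (as averaging does not increase suprema) or raises \<open>i\<close>.\<close>

theorem hit_upper:
  assumes p: "\<And>y. p * pmf (block_step h) y \<le> pmf \<mu> y" "0 < p" "p \<le> 1"
  shows "hit \<mu> n x \<le> (1 - p) ^ n + 1 / (real (2 * h + 1) * sqrt ((real n + 1) * p))"
proof -
  let ?K = "avg (block_step h)" and ?M = "real (2 * h + 1)"
  define g where "g j = of_bool (j = 0) + 1 / (?M * sqrt (real j + 1))" for j
  have bK: "bounded_by 1 ((?K ^^ i) point0)" for i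
    by (rule bounded_by_avg_pow[OF bounded_by_point0])
  have g0: "(?K ^^ i) point0 y \<le> g i" for i y
  proof (cases "i = 0")
    case True
    then show ?thesis by (simp add: g_def)
  next
    case False
    then show ?thesis using block_step_pow_le[of i h y] by (simp add: g_def)
  qed
  \<comment> \<open>\<open>n\<close> general steps after \<open>i\<close> elementary ones\<close>
  have "(avg \<mu> ^^ n) ((?K ^^ i) point0) y \<le> (\<Sum>j\<le>n. binomial_weight p n j * g (i + j))" for n i y
  proof (induction n arbitrary: i y)
    case 0
    then show ?case using g0 by (simp add: binomial_weight_def)
  next
    case (Suc n)
    let ?f = "(avg \<mu> ^^ n) ((?K ^^ i) point0)"
    have b: "0 \<le> ?f x" for x using bounded_by_avg_pow[OF bK, of n \<mu> i] by (simp add: bounded_by_def)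
    have "avg \<mu> ?f y \<le> (1 - p) * (\<Sum>j\<le>n. binomial_weight p n j * g (i + j)) + p * ?K ?f y"
      using avg_remainder_le[where f = ?f and c = "\<Sum>j\<le>n. binomial_weight p n j * g (i + j)" and x = y,
          OF p(1) _ b Suc] p by simp
    also have "?K ?f y = (avg \<mu> ^^ n) ((?K ^^ Suc i) point0) y"
      by (simp add: avg_pow_comm_block[OF bK])
    also have "\<dots> \<le> (\<Sum>j\<le>n. binomial_weight p n j * g (Suc i + j))" by (rule Suc)
    finally show ?case
      unfolding binomial_weight_sum_Suc[of p n "\<lambda>j. g (i + j)"] using p by simp
  qed
  from this[of n 0 x] have "hit \<mu> n x \<le> (\<Sum>j\<le>n. binomial_weight p n j * g j)" by simp
  also have "\<dots> = (\<Sum>j\<le>n. binomial_weight p n j * of_bool (j = 0)) + (\<Sum>j\<le>n. binomial_weight p n j / sqrt (real j + 1)) / ?M"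
    unfolding g_def by (simp add: distrib_left sum.distrib sum_divide_distrib mult.commute)
  also have "(\<Sum>j\<le>n. binomial_weight p n j * of_bool (j = 0)) = (1 - p) ^ n"
    by (subst sum.remove[of _ 0]) (auto simp: binomial_weight_def)
  also have "(\<Sum>j\<le>n. binomial_weight p n j / sqrt (real j + 1)) / ?M \<le> 1 / sqrt ((real n + 1) * p) / ?M"
    by (intro divide_right_mono binomial_weight_sqrt p) auto
  finally show ?thesis by (simp add: mult.commute)
qed

section \<open>Unimodality\<close>

text \<open>Symmetric unimodal functions: non-increasing in \<open>\<bar>x\<bar>\<close>, which includes evenness.\<close>

definition unimodal :: "(int \<Rightarrow> real) \<Rightarrow> bool" where
  "unimodal f \<longleftrightarrow> (\<forall>x y. \<bar>x\<bar> \<le> \<bar>y\<bar> \<longrightarrow> f y \<le> f x)"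

lemma unimodalD: "unimodal f \<Longrightarrow> \<bar>x\<bar> \<le> \<bar>y\<bar> \<Longrightarrow> f y \<le> f x"
  by (auto simp: unimodal_def)

lemma unimodalI:
  assumes even: "\<And>x. f (- x) = f x" and dec: "\<And>x. x \<ge> 0 \<Longrightarrow> f (x + 1) \<le> f x"
  shows "unimodal f"
proof -
  have "f (int a + int k) \<le> f (int a)" for a k :: nat
  proof (induction k)
    case (Suc k)
    then show ?case using dec[of "int a + int k"] by (simp add: algebra_simps)
  qed simp
  then have "f y \<le> f x" if "0 \<le> x" "x \<le> y" for x y
    using that by (metis nonneg_int_cases zle_iff_zadd)
  moreover have "f \<bar>x\<bar> = f x" for x using even[of x] by (simp add: abs_if)
  ultimately show ?thesis unfolding unimodal_def by (metis abs_ge_zero)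
qed

lemma unif_avg_shift_diff:
  "unif_avg h f x - unif_avg h f (x + 1) = (f (x - h) - f (x + h + 1)) / real (2 * h + 1)"
proof -
  let ?s = "{- int h..int h}"
  have "{- int h..int h + 1} = insert (int h + 1) ?s" by auto
  then have "(\<Sum>u\<in>?s. f (x + u)) + f (x + h + 1) = (\<Sum>u\<in>{- int h..int h + 1}. f (x + u))"
    by (simp add: algebra_simps)
  also have "{- int h..int h + 1} = insert (- int h) ((\<lambda>u. u + 1) ` ?s)"
    by (force simp: image_iff Bex_def intro: exI[of _ "x - 1" for x])
  also have "(\<Sum>u\<in>\<dots>. f (x + u)) = f (x - h) + (\<Sum>u\<in>?s. f (x + 1 + u))"
    by (subst sum.insert) (auto simp: sum.reindex inj_on_def add_ac simp del: image_add_atLeastAtMost')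
  finally show ?thesis
    unfolding unif_avg_def by (simp add: diff_divide_distrib[symmetric])
qed

text \<open>The difference of the averages at \<open>x\<close> and \<open>x + 1\<close> telescopes to a multiple of the difference of the coin
  averages at \<open>x - h\<close> and \<open>x + h + 1\<close>. Both of these involve the values of \<open>f\<close> at \<open>x - h\<close> and \<open>x + h + 1\<close>, with weights
  \<open>2, 1\<close> and \<open>1, 2\<close>; the two remaining points are likewise ordered by modulus.\<close>

lemma unimodal_avg_block:
  assumes f: "unimodal f"
  shows "unimodal (avg (block_step h) f)"
proof (rule unimodalI)
  let ?m = "2 * int h + 1"
  have ev: "f (- x) = f x" for x using unimodalD[OF f, of x "-x"] unimodalD[OF f, of "-x" x] by simp
  have cev: "coin_avg ?m f (- x) = coin_avg ?m f x" for x
  proof -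
    have "- x - ?m = - (x + ?m)" "- x + ?m = - (x - ?m)" by simp_all
    then show ?thesis unfolding coin_avg_def by (simp only: ev add_ac)
  qed
  show "avg (block_step h) f (- x) = avg (block_step h) f x" for x
  proof -
    have "(\<Sum>u\<in>{- int h..int h}. coin_avg ?m f (- x + u)) = (\<Sum>u\<in>{- int h..int h}. coin_avg ?m f (x + u))"
    proof (rule sum.reindex_bij_witness[of _ uminus uminus])
      show "coin_avg ?m f (x + - u) = coin_avg ?m f (- x + u)" for u
        using cev[of "x - u"] by simp
    qed auto
    then show ?thesis by (simp add: avg_block_step unif_avg_def)
  qed
  fix x :: int assume x: "x \<ge> 0"
  have "coin_avg ?m f (x + h + 1) \<le> coin_avg ?m f (x - h)"
  proof -
    have e: "x + h + 1 - ?m = x - h" "x - h + ?m = x + h + 1" by simp_all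
    have "f (x + h + 1) \<le> f (x - h)" "f (x + h + 1 + ?m) \<le> f (x - h - ?m)"
      using x by (auto intro!: unimodalD[OF f])
    then have "f (x - h) + 2 * f (x + h + 1) + f (x + h + 1 + ?m) \<le> f (x - h - ?m) + 2 * f (x - h) + f (x + h + 1)"
      by (smt (verit))
    then show ?thesis unfolding coin_avg_def e by (rule divide_right_mono) simp
  qed
  then have "0 \<le> unif_avg h (coin_avg ?m f) x - unif_avg h (coin_avg ?m f) (x + 1)"
    unfolding unif_avg_shift_diff by simp
  then show "avg (block_step h) f (x + 1) \<le> avg (block_step h) f x"
    by (simp add: avg_block_step)
qed

lemma unimodal_avg_mixture:
  assumes f: "unimodal f" "bounded_by B f"
  shows "unimodal (avg (bind_pmf l (\<lambda>j. block_step (h j))) f)"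
  unfolding unimodal_def
proof (intro allI impI)
  fix x y :: int assume xy: "\<bar>x\<bar> \<le> \<bar>y\<bar>"
  have e: "avg (bind_pmf l (\<lambda>j. block_step (h j))) f z =
      measure_pmf.expectation l (\<lambda>j. avg (block_step (h j)) f z)" for z
    unfolding avg_def by (rule expectation_bind_pmf) (use f(2) in \<open>auto simp: bounded_by_def\<close>)
  show "avg (bind_pmf l (\<lambda>j. block_step (h j))) f y \<le> avg (bind_pmf l (\<lambda>j. block_step (h j))) f x"
    unfolding e
  proof (rule integral_mono)
    have "integrable (measure_pmf l) (\<lambda>j. avg (block_step (h j)) f z)" for z
      by (rule integrable_bounded_by[where B = B]) (use bounded_by_avg[OF f(2)] in \<open>auto simp: bounded_by_def\<close>)
    from this[of y] this[of x] show "integrable (measure_pmf l) (\<lambda>j. avg (block_step (h j)) f y)"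
      "integrable (measure_pmf l) (\<lambda>j. avg (block_step (h j)) f x)" by auto
    show "avg (block_step (h j)) f y \<le> avg (block_step (h j)) f x" for j
      by (rule unimodalD[OF unimodal_avg_block[OF f(1)] xy])
  qed
qed

lemma unimodal_hit: "unimodal (hit (bind_pmf l (\<lambda>j. block_step (h j))) n)"
proof (induction n)
  case 0
  then show ?case by (auto simp: unimodal_def)
next
  case (Suc n)
  then show ?case using unimodal_avg_mixture[OF Suc bounded_by_hit] by simp
qed

section \<open>Truncated second moments\<close>

text \<open>Truncated squares grow at most linearly in time. Symmetry of the step law replaces
  the cross term by the parallelogram identity, and truncation is subadditive.\<close>

lemma avg_truncated_square:
  assumes sym: "symmetric_pmf \<mu>" and R: "0 \<le> R"
  shows "avg \<mu> (\<lambda>x. min ((real_of_int x)\<^sup>2) R) x \<le>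
    min ((real_of_int x)\<^sup>2) R + avg \<mu> (\<lambda>x. min ((real_of_int x)\<^sup>2) R) 0"
proof -
  let ?f = "\<lambda>x. min ((real_of_int x)\<^sup>2) R"
  have b: "bounded_by R ?f" using R by (auto simp: bounded_by_def)
  have "map_pmf uminus \<mu> = \<mu>"
  proof (rule pmf_eqI)
    fix i show "pmf (map_pmf uminus \<mu>) i = pmf \<mu> i"
      using pmf_map_inj'[of uminus \<mu> "- i"] sym by (simp add: symmetric_pmf_def)
  qed
  then have refl: "avg \<mu> ?f x = measure_pmf.expectation \<mu> (\<lambda>y. ?f (x - y))"
    unfolding avg_def by (metis (mono_tags, lifting) integral_map_pmf Bochner_Integration.integral_cong diff_conv_add_uminus)
  have I: "integrable (measure_pmf \<mu>) (\<lambda>y. ?f (x + y))" "integrable (measure_pmf \<mu>) (\<lambda>y. ?f (x - y))"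
    "integrable (measure_pmf \<mu>) ?f"
    using R by (auto intro!: integrable_bounded_by[where B = R])
  have "2 * avg \<mu> ?f x = measure_pmf.expectation \<mu> (\<lambda>y. ?f (x + y) + ?f (x - y))"
    using I refl by (simp add: avg_def)
  also have "\<dots> \<le> measure_pmf.expectation \<mu> (\<lambda>y. 2 * (?f x + ?f y))"
  proof (rule integral_mono)
    show "?f (x + y) + ?f (x - y) \<le> 2 * (?f x + ?f y)" for y
    proof -
      have "(real_of_int (x + y))\<^sup>2 + (real_of_int (x - y))\<^sup>2 = 2 * ((real_of_int x)\<^sup>2 + (real_of_int y)\<^sup>2)"
        by (simp add: power2_eq_square algebra_simps)
      moreover have "0 \<le> (real_of_int x)\<^sup>2" "0 \<le> (real_of_int y)\<^sup>2" by auto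
      ultimately show ?thesis using R unfolding min_def by (smt (verit))
    qed
  qed (use I in auto)
  also have "\<dots> = 2 * (?f x + avg \<mu> ?f 0)"
    using I by (simp add: avg_def)
  finally show ?thesis by simp
qed

lemma avg_pow_truncated_square:
  assumes sym: "symmetric_pmf \<mu>" and R: "0 \<le> R"
  shows "(avg \<mu> ^^ n) (\<lambda>x. min ((real_of_int x)\<^sup>2) R) x \<le>
    min ((real_of_int x)\<^sup>2) R + n * avg \<mu> (\<lambda>x. min ((real_of_int x)\<^sup>2) R) 0"
proof (induction n arbitrary: x)
  case (Suc n)
  let ?f = "\<lambda>x. min ((real_of_int x)\<^sup>2) R"
  let ?c = "n * avg \<mu> ?f 0"
  have b: "bounded_by R ?f" using R by (auto simp: bounded_by_def)
  have c: "0 \<le> ?c" using bounded_by_avg[OF b, of \<mu>] by (simp add: bounded_by_def)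
  have "(avg \<mu> ^^ Suc n) ?f x \<le> avg \<mu> (\<lambda>x. ?f x + ?c) x"
    using Suc by (auto intro!: avg_mono[of R _ "R + ?c"] bounded_by_avg_pow b) (use c b in \<open>auto simp: bounded_by_def\<close>)
  also have "\<dots> = avg \<mu> ?f x + ?c"
    using avg_integrable[OF b, of \<mu> x] by (simp add: avg_def)
  also have "\<dots> \<le> ?f x + avg \<mu> ?f 0 + ?c"
    using avg_truncated_square[OF sym R, of x] by simp
  finally show ?case by (simp add: algebra_simps)
qed simp

section \<open>Lower bounds from unimodality\<close>

lemma hit_nonneg: "0 \<le> hit \<mu> n x"
  using bounded_by_hit unfolding bounded_by_def by blast

lemma hit_le_1: "hit \<mu> n x \<le> 1"
  using bounded_by_hit unfolding bounded_by_def by blast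



lemma avg_pow_unif:
  assumes "bounded_by B f"
  shows "(avg \<mu> ^^ n) (unif_avg h f) = unif_avg h ((avg \<mu> ^^ n) f)"
  by (induction n) (simp_all add: avg_coin_unif(1)[OF bounded_by_avg_pow[OF assms]])

lemma avg_pow_ge:
  assumes f: "bounded_by B f" and g: "bounded_by C g" and D: "0 \<le> D" and le: "\<And>x. 1 \<le> f x + D * g x"
  shows "1 \<le> (avg \<mu> ^^ n) f x + D * (avg \<mu> ^^ n) g x"
proof (induction n arbitrary: x)
  case 0
  then show ?case using le by simp
next
  case (Suc n)
  let ?f = "(avg \<mu> ^^ n) f" and ?g = "(avg \<mu> ^^ n) g"
  have b: "bounded_by B ?f" "bounded_by C ?g" using f g by (auto intro: bounded_by_avg_pow)
  then have "bounded_by (B + D * C) (\<lambda>x. ?f x + D * ?g x)"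
    using D by (auto simp: bounded_by_def intro!: add_mono mult_left_mono)
  from avg_mono[where f = "\<lambda>_. 1", OF _ this Suc, of 1] have "1 \<le> avg \<mu> (\<lambda>x. ?f x + D * ?g x) x"
    by (simp add: bounded_by_def avg_def[of _ "\<lambda>_. 1"])
  then show ?case
    using avg_integrable[OF b(1), of \<mu> x] avg_integrable[OF b(2), of \<mu> x]
    by (simp add: avg_def[of _ ?f] avg_def[of _ ?g] avg_def[of _ "\<lambda>x. ?f x + D * ?g x"])
qed

text \<open>Chebyshev's inequality, with the sum of return probabilities over an interval identified as the
  iterated average of the indicator of the interval. The indicator is a multiple of a uniform average of
  \<open>point0\<close>, and uniform averages commute with the transition operator.\<close>

lemma hit_mass:
  assumes sym: "symmetric_pmf \<mu>" and R: "R \<ge> 1"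
  shows "1 \<le> (\<Sum>u\<in>{- int R..int R}. hit \<mu> n u) +
    n * avg \<mu> (\<lambda>x. min ((real_of_int x)\<^sup>2) ((real R)\<^sup>2)) 0 / (real R)\<^sup>2"
proof -
  let ?f = "\<lambda>x. min ((real_of_int x)\<^sup>2) ((real R)\<^sup>2)"
  let ?M = "real (2 * R + 1)"
  let ?U = "unif_avg R point0"
  have U: "?U z = of_bool (\<bar>z\<bar> \<le> R) / ?M" for z
  proof -
    have "(\<Sum>u\<in>{- int R..int R}. point0 (z + u)) = (\<Sum>u\<in>{- int R..int R}. if u = - z then 1 else 0)"
      by (intro sum.cong) auto
    then show ?thesis by (auto simp: unif_avg_def)
  qed
  have "1 \<le> (avg \<mu> ^^ n) (\<lambda>z. of_bool (\<bar>z\<bar> \<le> R)) 0 + 1 / (real R)\<^sup>2 * (avg \<mu> ^^ n) ?f 0"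
  proof (rule avg_pow_ge)
    show "bounded_by 1 (\<lambda>z. of_bool (\<bar>z\<bar> \<le> R))" "bounded_by ((real R)\<^sup>2) ?f" by (auto simp: bounded_by_def)
    show "1 \<le> of_bool (\<bar>z\<bar> \<le> R) + 1 / (real R)\<^sup>2 * ?f z" for z
    proof (cases "\<bar>z\<bar> \<le> R")
      case False
      then have "real R \<le> \<bar>real_of_int z\<bar>" by linarith
      then have "(real R)\<^sup>2 \<le> (real_of_int z)\<^sup>2" by (metis abs_le_square_iff abs_of_nat)
      then show ?thesis using R by (simp add: min_def)
    qed auto
  qed simp
  also have "(avg \<mu> ^^ n) ?f 0 \<le> n * avg \<mu> ?f 0"
    using avg_pow_truncated_square[OF sym, of "(real R)\<^sup>2" n 0] by simp
  also have "(avg \<mu> ^^ n) (\<lambda>z. of_bool (\<bar>z\<bar> \<le> R)) 0 = ?M * (avg \<mu> ^^ n) ?U 0"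
  proof -
    have "(avg \<mu> ^^ n) (\<lambda>z. c * f z) x = c * (avg \<mu> ^^ n) f x" for c f x
      by (induction n arbitrary: x) (simp_all add: avg_def)
    from this[of ?M ?U 0] show ?thesis by (simp add: U)
  qed
  also have "(avg \<mu> ^^ n) ?U 0 = unif_avg R (hit \<mu> n) 0"
    by (simp add: avg_pow_unif[OF bounded_by_point0])
  also have "?M * \<dots> = (\<Sum>u\<in>{- int R..int R}. hit \<mu> n u)"
    by (simp add: unif_avg_def)
  finally show ?thesis by (simp add: mult_left_mono divide_right_mono)
qed

text \<open>At least \<open>3 / 4\<close> of the mass lies in \<open>{- R..R}\<close> and at most \<open>1 / 4\<close> within distance \<open>d\<close> of the origin. The rest
  is spread over at most \<open>2 R + 1\<close> points where, by unimodality, the mass does not exceed the one at \<open>d\<close>.\<close>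

lemma hit_lower:
  assumes sym: "symmetric_pmf \<mu>" and R: "R \<ge> 1" and um: "unimodal (hit \<mu> n)"
    and d: "(2 * real d + 1) * hit \<mu> n 0 \<le> 1 / 4"
    and w: "n * avg \<mu> (\<lambda>x. min ((real_of_int x)\<^sup>2) ((real R)\<^sup>2)) 0 \<le> (real R)\<^sup>2 / 4"
    and y: "\<bar>y\<bar> \<le> int d"
  shows "1 / (6 * real R) \<le> hit \<mu> n y"
proof -
  have h0: "0 \<le> hit \<mu> n x" for x by (rule hit_nonneg)
  have "n * avg \<mu> (\<lambda>x. min ((real_of_int x)\<^sup>2) ((real R)\<^sup>2)) 0 / (real R)\<^sup>2 \<le> 1 / 4"
    using w R by (simp add: field_simps)
  moreover note hit_mass[OF sym R, where n = n]
  ultimately have "3 / 4 \<le> (\<Sum>u\<in>{- int R..int R}. hit \<mu> n u)"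
    by linarith
  also have "\<dots> \<le> (\<Sum>u\<in>{- int R..int R}. (if u \<in> {- int d..int d} then hit \<mu> n 0 else 0) + hit \<mu> n d)"
  proof (intro sum_mono)
    fix u show "hit \<mu> n u \<le> (if u \<in> {- int d..int d} then hit \<mu> n 0 else 0) + hit \<mu> n d"
      using unimodalD[OF um, of 0 u] unimodalD[OF um, of d u] h0[of d] by auto
  qed
  also have "\<dots> = (\<Sum>u\<in>{- int R..int R} \<inter> {- int d..int d}. hit \<mu> n 0) + (2 * real R + 1) * hit \<mu> n d"
    unfolding sum.distrib by (subst sum.inter_restrict) auto
  also have "(\<Sum>u\<in>{- int R..int R} \<inter> {- int d..int d}. hit \<mu> n 0) \<le> (\<Sum>u\<in>{- int d..int d}. hit \<mu> n 0)"
    by (intro sum_mono2) (auto simp: h0)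
  also have "\<dots> = (2 * real d + 1) * hit \<mu> n 0" by simp
  finally have "1 / 2 \<le> (2 * real R + 1) * hit \<mu> n d" using d by linarith
  also have "\<dots> \<le> (3 * real R) * hit \<mu> n d" using R h0 by (intro mult_right_mono) auto
  finally have "1 / (6 * real R) \<le> hit \<mu> n d" using R by (simp add: field_simps)
  then show ?thesis using unimodalD[OF um, of y d] y by simp
qed

section \<open>The step distribution\<close>

text \<open>The binary logarithm of the rarity \<open>Q\<^sub>k\<close> of level \<open>k\<close>. In terms of the width \<open>h\<^sub>k\<close> defined next, the recursion reads
  \<open>Q\<^sub>k\<^sub>+\<^sub>1 = 2 ^ (16 h\<^sub>k)\<close>. Powers of two make the harmonic sums over the scales easy to evaluate; the factor
  \<open>16\<close> leaves room for \<open>scale_end_le\<close>.\<close>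

fun scale_exp :: "nat \<Rightarrow> nat" where
  "scale_exp 0 = 0"
| "scale_exp (Suc k) = 16 * 2 ^ (2 * k + scale_exp k)"

declare scale_exp.simps(2) [simp del]

text \<open>The width \<open>h\<^sub>k = 4\<^sup>k Q\<^sub>k\<close> of the elementary step of level \<open>k\<close>.\<close>

definition width :: "nat \<Rightarrow> nat" where "width k = 2 ^ (2 * k + scale_exp k)"

text \<open>The level is \<open>k\<close> or higher with probability \<open>1 / rarity k\<close>.\<close>

definition rarity :: "nat \<Rightarrow> nat" where "rarity k = 2 ^ scale_exp k"

lemma scale_exp_Suc: "scale_exp (Suc k) = 16 * width k"
  by (simp add: width_def scale_exp.simps)

lemma less_width: "2 * k + scale_exp k < width k"
  by (simp add: width_def)

lemma width_pos: "width k \<ge> 1"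
  by (simp add: width_def)

lemma rarity_pos: "rarity k \<ge> 1"
  by (simp add: rarity_def)

lemma width_eq: "width k = 4 ^ k * rarity k"
  by (simp add: width_def rarity_def power_add power_mult)

lemma rarity_Suc_ge: "2 * rarity k \<le> rarity (Suc k)"
proof -
  have "scale_exp k + 1 \<le> scale_exp (Suc k)" using less_width[of k] by (simp add: scale_exp_Suc del: scale_exp.simps)
  then have "2 ^ (scale_exp k + 1) \<le> (2 ^ scale_exp (Suc k) :: nat)" by (rule power_increasing) simp
  then show ?thesis by (simp add: rarity_def del: scale_exp.simps)
qed

lemma width_Suc_ge: "4 * width k \<le> width (Suc k)"
  using mult_mono[OF order_refl[of "4 ^ Suc k"] rarity_Suc_ge[of k]] by (simp add: width_eq)

lemma width_less: "j < k \<Longrightarrow> 4 * width j \<le> width k"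
proof (induction k)
  case (Suc k)
  then show ?case using width_Suc_ge[of k] by (cases "j = k") auto
qed simp

text \<open>The probability of level \<open>k\<close>, a difference of consecutive tails.\<close>

definition level_prob :: "nat \<Rightarrow> real" where "level_prob k = 1 / rarity k - 1 / rarity (Suc k)"

lemma level_prob_ge: "1 / (2 * rarity k) \<le> level_prob k"
proof -
  have "1 / real (rarity (Suc k)) \<le> 1 / (2 * rarity k)"
    using rarity_Suc_ge[of k] rarity_pos[of k] by (intro divide_left_mono) auto
  then show ?thesis by (simp add: level_prob_def field_simps)
qed

lemma level_prob_pos: "0 < level_prob k"
proof -
  have "0 < 1 / real (2 * rarity k)" using rarity_pos[of k] by simp
  then show ?thesis using level_prob_ge[of k] by (rule less_le_trans)
qed

lemma level_prob_le: "level_prob k \<le> 1 / rarity k"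
  by (simp add: level_prob_def)

lemma level_prob_le1: "level_prob k \<le> 1"
proof -
  have "1 / real (rarity k) \<le> 1" using rarity_pos[of k] by simp
  then show ?thesis using level_prob_le[of k] by simp
qed

lemma sum_level_prob: "(\<Sum>j\<le>k. level_prob j) = 1 - 1 / rarity (Suc k)"
  by (induction k) (simp_all add: level_prob_def rarity_def)

lemma rarity_ge: "k < rarity k"
proof (induction k)
  case (Suc k)
  then show ?case using rarity_Suc_ge[of k] by linarith
qed (simp add: rarity_def)

lemma level_prob_sums: "level_prob sums 1"
proof -
  have "(\<lambda>k. 1 - 1 / real (rarity (Suc k))) \<longlonglongrightarrow> 1 - 0"
  proof (intro tendsto_diff tendsto_const)
    show "(\<lambda>k. 1 / real (rarity (Suc k))) \<longlonglongrightarrow> 0"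
    proof (rule tendsto_sandwich[of "\<lambda>_. 0" _ _ "\<lambda>k. 1 / real (Suc k)"])
      show "\<forall>\<^sub>F k in sequentially. 1 / real (rarity (Suc k)) \<le> 1 / real (Suc k)"
      proof (intro always_eventually allI divide_left_mono)
        show "real (Suc k) \<le> real (rarity (Suc k))" for k using rarity_ge[of "Suc k"] by linarith
      qed (auto simp: rarity_def simp del: scale_exp.simps)
      show "(\<lambda>k. 1 / real (Suc k)) \<longlonglongrightarrow> 0" by (rule lim_1_over_n[THEN LIMSEQ_Suc])
    qed auto
  qed
  then have "(\<lambda>k. \<Sum>j\<le>k. level_prob j) \<longlonglongrightarrow> 1" by (simp add: sum_level_prob)
  then show ?thesis by (simp add: sums_def_le)
qed

definition level :: "nat pmf" where "level = embed_pmf level_prob"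

lemma pmf_level: "pmf level k = level_prob k"
  unfolding level_def
proof (rule pmf_embed_pmf)
  show "0 \<le> level_prob x" for x using level_prob_pos[of x] by simp
  have "(\<integral>\<^sup>+x. ennreal (level_prob x) \<partial>count_space UNIV) = (\<Sum>k. ennreal (level_prob k))"
    by (simp add: nn_integral_count_space_nat)
  also have "\<dots> = ennreal (suminf level_prob)"
    using level_prob_sums level_prob_pos less_imp_le by (intro suminf_ennreal2) (auto simp: sums_iff)
  finally show "(\<integral>\<^sup>+x. ennreal (level_prob x) \<partial>count_space UNIV) = 1"
    using level_prob_sums by (simp add: sums_iff)
qed

lemma level_tail: "measure_pmf.prob level {k<..} = 1 / rarity (Suc k)"
proof -
  have "measure_pmf.prob level {k<..} = 1 - measure_pmf.prob level {..k}"
    using measure_pmf.prob_compl[of "{..k}" level] by (simp add: Compl_eq_Diff_UNIV[symmetric])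
  also have "measure_pmf.prob level {..k} = (\<Sum>j\<le>k. level_prob j)"
    by (simp add: measure_measure_pmf_finite pmf_level)
  finally show ?thesis by (simp add: sum_level_prob)
qed

text \<open>The step law: choose a level at random, then make an elementary step of the width of that level.\<close>

definition step_law :: "int pmf" where "step_law = bind_pmf level (\<lambda>k. block_step (width k))"

lemma unimodal_hit_step_law: "unimodal (hit step_law n)"
  unfolding step_law_def by (rule unimodal_hit)

lemma step_law_dominates: "level_prob k * pmf (block_step (width k)) y \<le> pmf step_law y"
proof -
  have "level_prob k * pmf (block_step (width k)) y =
      measure_pmf.expectation level (\<lambda>j. if j = k then pmf (block_step (width k)) y else 0)"
    by (subst integral_measure_pmf[of "{k}"]) (auto simp: pmf_level split: if_splits)
  also have "\<dots> \<le> measure_pmf.expectation level (\<lambda>j. pmf (block_step (width j)) y)"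
    by (intro integral_mono integrable_bounded_by[where B = 1]) (auto simp: pmf_le_1)
  also have "\<dots> = pmf step_law y" by (simp add: step_law_def pmf_bind)
  finally show ?thesis .
qed

lemma symmetric_block_step: "symmetric_pmf (block_step h)"
  unfolding symmetric_pmf_def
proof
  fix k
  let ?A = "{- int h..int h} \<times> (UNIV :: (bool \<times> bool) set)"
  let ?f = "\<lambda>(u, c, d). u + (2 * int h + 1) * (of_bool c - of_bool d)"
  let ?g = "\<lambda>(u :: int, c :: bool, d :: bool). (- u, d, c)"
  have "map_pmf ?g (pmf_of_set ?A) = pmf_of_set (?g ` ?A)"
    by (intro map_pmf_of_set_inj) (auto simp: inj_on_def)
  also have "?g ` ?A = ?A"
  proof
    show sub: "?g ` ?A \<subseteq> ?A" by auto
    have "?g ` ?g ` ?A = ?A" by (simp add: image_image case_prod_beta')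
    with image_mono[OF sub, of ?g] show "?A \<subseteq> ?g ` ?A" by simp
  qed
  finally have g: "map_pmf ?g (pmf_of_set ?A) = pmf_of_set ?A" .
  have "map_pmf uminus (block_step h) = map_pmf uminus (map_pmf ?f (map_pmf ?g (pmf_of_set ?A)))"
    unfolding g block_step_def ..
  also have "\<dots> = map_pmf (uminus \<circ> ?f \<circ> ?g) (pmf_of_set ?A)"
    by (simp only: map_pmf_compose o_apply)
  also have "uminus \<circ> ?f \<circ> ?g = ?f" by (auto simp: fun_eq_iff algebra_simps)
  finally have "map_pmf uminus (block_step h) = block_step h" by (simp add: block_step_def)
  then show "pmf (block_step h) k = pmf (block_step h) (- k)"
    using pmf_map_inj'[of uminus "block_step h" "k"] by simp
qed

lemma symmetric_step_law: "symmetric_pmf step_law"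
  using symmetric_block_step by (simp add: symmetric_pmf_def step_law_def pmf_bind)

lemma avg_step_law: "bounded_by B f \<Longrightarrow> avg step_law f x = measure_pmf.expectation level (\<lambda>j. avg (block_step (width j)) f x)"
  unfolding avg_def step_law_def by (rule expectation_bind_pmf) (auto simp: bounded_by_def)

lemma block_step_range:
  assumes "y \<in> set_pmf (block_step h)"
  shows "\<bar>y\<bar> \<le> 3 * int h + 1"
proof -
  obtain u c d where "y = u + (2 * int h + 1) * (of_bool c - of_bool d)" "u \<in> {- int h..int h}"
    using assms by (auto simp: block_step_def set_pmf_of_set)
  then show ?thesis by (cases c; cases d) auto
qed

lemma avg_block_step_le:
  assumes "\<And>y. \<bar>y\<bar> \<le> 3 * int h + 1 \<Longrightarrow> f y \<le> c" "bounded_by B f"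
  shows "avg (block_step h) f 0 \<le> c"
  unfolding avg_def
  using assms(1) block_step_range avg_integrable[OF assms(2), of _ 0]
  by (intro measure_pmf.integral_le_const) (auto simp: AE_measure_pmf_iff)

text \<open>Levels up to \<open>k\<close> contribute at most a multiple of \<open>h\<^sub>k\<^sup>2 / Q\<^sub>k\<close>, as \<open>h\<^sub>j\<^sup>2 / Q\<^sub>j = 16\<^sup>j Q\<^sub>j\<close> is
  dominated by a geometric series; higher levels contribute the truncation value times their probability.\<close>

lemma truncated_variance_step_law:
  "avg step_law (\<lambda>x. min ((real_of_int x)\<^sup>2) ((real R)\<^sup>2)) 0 \<le>
    32 * (real (width k))\<^sup>2 / rarity k + (real R)\<^sup>2 / rarity (Suc k)"
proof -
  let ?f = "\<lambda>x. min ((real_of_int x)\<^sup>2) ((real R)\<^sup>2)"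
  have b: "bounded_by ((real R)\<^sup>2) ?f" by (auto simp: bounded_by_def)
  let ?g = "\<lambda>j. avg (block_step (width j)) ?f 0"
  have g: "0 \<le> ?g j" "?g j \<le> (real R)\<^sup>2" for j
    using bounded_by_avg[OF b] by (auto simp: bounded_by_def)
  have gj: "?g j \<le> 16 * (real (width j))\<^sup>2" for j
  proof (rule avg_block_step_le[OF _ b])
    fix y assume "\<bar>y\<bar> \<le> 3 * int (width j) + 1"
    then have "\<bar>y\<bar> \<le> 4 * int (width j)" using width_pos[of j] by linarith
    then have "\<bar>real_of_int y\<bar> \<le> \<bar>4 * real (width j)\<bar>" by linarith
    then have "(real_of_int y)\<^sup>2 \<le> (4 * real (width j))\<^sup>2" by (simp only: abs_le_square_iff)
    then show "?f y \<le> 16 * (real (width j))\<^sup>2" by (simp add: power_mult_distrib)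
  qed
  have m: "16 * (real (width j))\<^sup>2 \<le> (\<Sum>j\<le>k. 16 * (real (width j))\<^sup>2)" if "j \<le> k" for j
    by (rule member_le_sum) (use that in auto)
  have "avg step_law ?f 0 = measure_pmf.expectation level ?g" by (rule avg_step_law[OF b])
  also have "\<dots> \<le> measure_pmf.expectation level
      (\<lambda>j. (if j \<in> {..k} then 16 * (real (width j))\<^sup>2 else 0) + (real R)\<^sup>2 * indicator {k<..} j)"
  proof (intro integral_mono)
    show "integrable (measure_pmf level) ?g" using g by (intro integrable_bounded_by)
    show "integrable (measure_pmf level)
      (\<lambda>j. (if j \<in> {..k} then 16 * (real (width j))\<^sup>2 else 0) + (real R)\<^sup>2 * indicator {k<..} j)"
      by (rule integrable_bounded_by[where B = "(\<Sum>j\<le>k. 16 * (real (width j))\<^sup>2) + (real R)\<^sup>2"])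
        (auto simp: indicator_def add_increasing2 sum_nonneg m)
    show "?g j \<le> (if j \<in> {..k} then 16 * (real (width j))\<^sup>2 else 0) + (real R)\<^sup>2 * indicator {k<..} j" for j
      using g[of j] gj[of j] by (auto simp: indicator_def)
  qed
  also have "\<dots> = measure_pmf.expectation level (\<lambda>j. if j \<in> {..k} then 16 * (real (width j))\<^sup>2 else 0) +
      (real R)\<^sup>2 * measure_pmf.prob level {k<..}"
  proof (subst Bochner_Integration.integral_add)
    show "integrable (measure_pmf level) (\<lambda>j. if j \<in> {..k} then 16 * (real (width j))\<^sup>2 else 0)"
      by (rule integrable_bounded_by[where B = "\<Sum>j\<le>k. 16 * (real (width j))\<^sup>2"]) (auto simp: m sum_nonneg)
    show "integrable (measure_pmf level) (\<lambda>j. (real R)\<^sup>2 * indicator {k<..} j)"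
      by (rule integrable_bounded_by[where B = "(real R)\<^sup>2"]) (auto simp: indicator_def)
  qed simp
  also have "measure_pmf.expectation level (\<lambda>j. if j \<in> {..k} then 16 * (real (width j))\<^sup>2 else 0) =
      (\<Sum>j\<le>k. level_prob j * (16 * (real (width j))\<^sup>2))"
    by (subst integral_measure_pmf[of "{..k}"]) (auto simp: pmf_level split: if_splits)
  also have "\<dots> \<le> (\<Sum>j\<le>k. 16 * (16 ^ j * real (rarity j)))"
  proof (intro sum_mono)
    fix j
    have "level_prob j * (16 * (real (width j))\<^sup>2) \<le> 1 / rarity j * (16 * (real (width j))\<^sup>2)"
      by (intro mult_right_mono level_prob_le) auto
    also have "\<dots> = 16 * (16 ^ j * real (rarity j))"
      using rarity_pos[of j] by (simp add: width_eq power2_eq_square power_mult_distrib[symmetric])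
    finally show "level_prob j * (16 * (real (width j))\<^sup>2) \<le> 16 * (16 ^ j * real (rarity j))" .
  qed
  also have "\<dots> \<le> 32 * (16 ^ k * real (rarity k))"
  proof (induction k)
    case (Suc k)
    have "(2::real) * rarity k \<le> rarity (Suc k)" using rarity_Suc_ge[of k] by linarith
    then have "16 ^ k * (2 * real (rarity k)) \<le> 16 ^ k * real (rarity (Suc k))"
      by (intro mult_left_mono) auto
    moreover have "0 \<le> 16 ^ k * real (rarity (Suc k))" by simp
    ultimately show ?case using Suc unfolding sum.atMost_Suc power_Suc mult.assoc mult.left_commute[of _ 2]
      by linarith
  qed simp
  also have "\<dots> = 32 * (real (width k))\<^sup>2 / rarity k"
    using rarity_pos[of k] by (simp add: width_eq power2_eq_square power_mult_distrib[symmetric])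
  finally show ?thesis by (simp add: level_tail)
qed

lemma prob_avg: "measure_pmf.prob \<mu> S = avg \<mu> (indicator S) 0"
  by (simp add: avg_def)

lemma bounded_by_indicator: "bounded_by 1 (indicator S)"
  by (auto simp: bounded_by_def indicator_def)

text \<open>Levels below \<open>k\<close> only produce steps of modulus at most \<open>h\<^sub>k\<close>.\<close>

lemma step_law_big_step: "measure_pmf.prob step_law {y. int (width k) < \<bar>y\<bar>} \<le> 1 / rarity k"
proof (cases k)
  case 0
  then show ?thesis using measure_pmf.prob_le_1 by (simp add: rarity_def)
next
  case (Suc i)
  let ?S = "{y. int (width k) < \<bar>y\<bar>}"
  have "measure_pmf.prob step_law ?S = measure_pmf.expectation level (\<lambda>j. avg (block_step (width j)) (indicator ?S) 0)"
    unfolding prob_avg by (rule avg_step_law[OF bounded_by_indicator])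
  also have "\<dots> \<le> measure_pmf.expectation level (indicator {i<..})"
  proof (intro integral_mono)
    show "integrable (measure_pmf level) (\<lambda>j. avg (block_step (width j)) (indicator ?S) 0)"
      by (rule integrable_bounded_by[where B = 1]) (use bounded_by_avg[OF bounded_by_indicator] in \<open>auto simp: bounded_by_def\<close>)
    show "avg (block_step (width j)) (indicator ?S) 0 \<le> indicator {i<..} j" for j
    proof (rule avg_block_step_le[OF _ bounded_by_indicator])
      fix y assume y: "\<bar>y\<bar> \<le> 3 * int (width j) + 1"
      show "indicator ?S y \<le> (indicator {i<..} j :: real)"
      proof (cases "j < k")
        case True
        then have "\<bar>y\<bar> \<le> int (width k)" using y width_less[OF True] width_pos[of j] by linarith
        then show ?thesis by simp
      qed (auto simp: Suc indicator_def)
    qed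
  qed (auto intro!: integrable_bounded_by[where B = 1])
  also have "\<dots> = 1 / rarity k" by (simp add: level_tail Suc)
  finally show ?thesis .
qed

text \<open>Already the part of level \<open>k\<close> on which the difference of the coin flips is \<open>- 1\<close> lies in this interval.\<close>

lemma step_law_crossing_step: "level_prob k / 4 \<le> measure_pmf.prob step_law {- 4 * int (width k)..- int (width k) - 1}"
proof -
  let ?h = "int (width k)"
  let ?S = "{- 4 * ?h..- ?h - 1}"
  have "unif_avg (width k) (\<lambda>_. 1 / 4) 0 \<le> unif_avg (width k) (coin_avg (2 * ?h + 1) (indicator ?S)) 0"
    unfolding unif_avg_def
  proof (intro divide_right_mono sum_mono)
    fix u assume "u \<in> {- ?h..?h}"
    then have "0 + u - (2 * ?h + 1) \<in> ?S" using width_pos[of k] by auto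
    then show "1 / 4 \<le> coin_avg (2 * ?h + 1) (indicator ?S) (0 + u)"
      unfolding coin_avg_def by (auto simp: indicator_def)
  qed simp
  then have "level_prob k * (1 / 4) \<le> level_prob k * avg (block_step (width k)) (indicator ?S) 0"
    using level_prob_pos[of k] by (simp add: avg_block_step unif_avg_const)
  also have "\<dots> \<le> avg step_law (indicator ?S) 0"
    using avg_dominated[OF step_law_dominates _ bounded_by_indicator] level_prob_pos[of k] by simp
  finally show ?thesis by (simp add: prob_avg)
qed

lemma step_law_zero: "1 / 12 \<le> pmf step_law 0"
proof -
  have "1 / 2 \<le> level_prob 0" using level_prob_ge[of 0] by (simp add: rarity_def)
  have "1 / 6 \<le> unif_avg 1 (coin_avg 3 (indicator {0})) 0"
  proof -
    have "{- 1..1::int} = {-1, 0, 1}" by auto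
    then show ?thesis by (simp add: unif_avg_def coin_avg_def)
  qed
  then have "1 / 6 \<le> avg (block_step (width 0)) (indicator {0}) 0"
    by (simp add: avg_block_step width_def)
  then have "1 / 2 * (1 / 6) \<le> level_prob 0 * avg (block_step (width 0)) (indicator {0}) 0"
    using \<open>1 / 2 \<le> level_prob 0\<close> by (intro mult_mono) auto
  also have "\<dots> \<le> avg step_law (indicator {0}) 0"
    using avg_dominated[OF step_law_dominates _ bounded_by_indicator] level_prob_pos[of 0] by simp
  finally show ?thesis by (simp add: prob_avg[symmetric] measure_pmf_single)
qed

section \<open>Return probabilities at the scales of the step distribution\<close>

text \<open>The first time at which level \<open>k\<close> is considered to govern the walk. It exceeds \<open>Q\<^sub>k\<close> by a factor of order \<open>h\<^sub>k\<close> so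
  that the probability of no step of level \<open>k\<close> is small compared with \<open>1 / h\<^sub>k\<close>; on the logarithmic scale of length
  \<open>h\<^sub>k\<close> this costs little.\<close>

definition scale_start :: "nat \<Rightarrow> nat" where "scale_start k = 1024 * width k * rarity k"

lemma hit_step_law_upper: "hit step_law n x \<le> (1 - level_prob k) ^ n + 1 / (real (2 * width k + 1) * sqrt ((real n + 1) * level_prob k))"
  by (rule hit_upper[OF step_law_dominates level_prob_pos level_prob_le1])

text \<open>The two terms of \<open>hit_upper\<close> are estimated separately: the spread of level \<open>k\<close> here, the probability of
  no step of that level in the lemmas that follow.\<close>

lemma spread_upper:
  "(1 / (real (2 * width k + 1) * sqrt ((real n + 1) * level_prob k)))\<^sup>2 \<le> real (rarity k) / (2 * (real (width k))\<^sup>2) * (1 / (real n + 1))"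
proof -
  have h: "1 \<le> real (width k)" and Q: "1 \<le> real (rarity k)" using width_pos[of k] rarity_pos[of k] by auto
  have p: "1 / (2 * real (rarity k)) \<le> level_prob k" "0 < level_prob k" using level_prob_ge[of k] level_prob_pos[of k] by auto
  have "(1 / (real (2 * width k + 1) * sqrt ((real n + 1) * level_prob k)))\<^sup>2 = 1 / ((real (2 * width k + 1))\<^sup>2 * ((real n + 1) * level_prob k))"
    using p by (simp add: power_divide power_mult_distrib)
  also have "\<dots> \<le> 1 / ((2 * real (width k))\<^sup>2 * ((real n + 1) * (1 / (2 * real (rarity k)))))"
    using h Q p by (intro divide_left_mono mult_mono power_mono mult_pos_pos zero_less_power) auto
  also have "\<dots> = real (rarity k) / (2 * (real (width k))\<^sup>2) * (1 / (real n + 1))"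
    using h Q by (simp add: power_mult_distrib)
  finally show ?thesis .
qed

lemma geom_upper: "(1 - level_prob k) ^ n \<le> 1 / (1 + real n * level_prob k)"
proof -
  have p: "0 < level_prob k" "level_prob k \<le> 1" using level_prob_pos level_prob_le1 by auto
  have "(1 - level_prob k) ^ n * (1 + real n * level_prob k) \<le> (1 - level_prob k) ^ n * (1 + level_prob k) ^ n"
    using p Bernoulli_inequality[of "level_prob k" n] by (intro mult_left_mono) auto
  also have "\<dots> = (1 - (level_prob k)\<^sup>2) ^ n"
    by (simp add: power_mult_distrib[symmetric] power2_eq_square algebra_simps)
  also have "\<dots> \<le> 1" using p by (intro power_le_one) (auto simp: power_le_one)
  finally show ?thesis using p by (simp add: pos_le_divide_eq add_pos_nonneg)
qed

lemma geom_sum: "(\<Sum>n<N. (1 - level_prob k) ^ n) \<le> 2 * real (rarity k)"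
proof -
  have p: "0 < level_prob k" "level_prob k \<le> 1" "1 / (2 * real (rarity k)) \<le> level_prob k" using level_prob_pos level_prob_le1 level_prob_ge[of k] by auto
  have Q: "1 \<le> real (rarity k)" using rarity_pos[of k] by auto
  have "level_prob k * (\<Sum>n<N. (1 - level_prob k) ^ n) = 1 - (1 - level_prob k) ^ N"
    using one_diff_power_eq[of "1 - level_prob k" N] by simp
  also have "\<dots> \<le> 1" using p by simp
  finally have "(\<Sum>n<N. (1 - level_prob k) ^ n) \<le> 1 / level_prob k" using p by (simp add: field_simps)
  also have "\<dots> \<le> 1 / (1 / (2 * real (rarity k)))" using p Q by (intro divide_left_mono) auto
  finally show ?thesis by simp
qed

lemma scale_start_geom: assumes "n \<ge> scale_start k" shows "(1 - level_prob k) ^ n \<le> 1 / (512 * real (width k))"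
proof -
  have h: "1 \<le> real (width k)" and Q: "1 \<le> real (rarity k)" using width_pos[of k] rarity_pos[of k] by auto
  have "512 * real (width k) = real (scale_start k) * (1 / (2 * rarity k))" using Q by (simp add: scale_start_def)
  also have "\<dots> \<le> real n * level_prob k" using assms level_prob_ge[of k] by (intro mult_mono) auto
  finally have "512 * real (width k) \<le> 1 + real n * level_prob k" by simp
  then have "1 / (1 + real n * level_prob k) \<le> 1 / (512 * real (width k))" using h by (intro divide_left_mono) auto
  with geom_upper[where k = k and n = n] show ?thesis by simp
qed

lemma hit_small:
  assumes n: "n \<ge> scale_start k"
  shows "(2 * real (2 * width k) + 1) * hit step_law n 0 \<le> 1 / 4"
proof -
  have h: "1 \<le> real (width k)" and Q: "1 \<le> real (rarity k)" using width_pos[of k] rarity_pos[of k] by auto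
  let ?u = "1 / (real (2 * width k + 1) * sqrt ((real n + 1) * level_prob k))"
  have "1024 * real (rarity k) \<le> 1024 * real (rarity k) * real (width k)" using h Q by simp
  also have "\<dots> \<le> real n + 1"
    using of_nat_mono[OF n[unfolded scale_start_def], where 'a = real] by (simp add: mult_ac)
  finally have n1: "1024 * real (rarity k) \<le> real n + 1" .
  have "?u\<^sup>2 \<le> real (rarity k) / (2 * (real (width k))\<^sup>2) * (1 / (real n + 1))" by (rule spread_upper)
  also have "\<dots> \<le> real (rarity k) / (2 * (real (width k))\<^sup>2) * (1 / (1024 * real (rarity k)))"
    using n1 Q by (intro mult_left_mono divide_left_mono) auto
  also have "\<dots> = 1 / (2048 * (real (width k))\<^sup>2)" using Q by simp
  also have "\<dots> \<le> 1 / (2025 * (real (width k))\<^sup>2)"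
    using h by (intro divide_left_mono mult_right_mono mult_pos_pos) auto
  also have "\<dots> = (1 / (45 * real (width k)))\<^sup>2"
    by (simp add: power_divide power_mult_distrib)
  finally have u: "?u \<le> 1 / (45 * real (width k))" by (rule power2_le_imp_le) simp
  have "hit step_law n 0 \<le> 1 / (512 * real (width k)) + 1 / (45 * real (width k))"
    using hit_step_law_upper[where n = n and k = k and x = 0] u scale_start_geom[OF n] by linarith
  then have "(2 * real (2 * width k) + 1) * hit step_law n 0 \<le> (5 * real (width k)) * (1 / (512 * real (width k)) + 1 / (45 * real (width k)))"
    using h by (intro mult_mono) (auto intro: hit_nonneg)
  also have "\<dots> = 5 / 512 + 5 / 45" using h by (simp add: distrib_left)
  finally show ?thesis by simp
qed

lemma hit_step_law_lower:
  assumes n: "scale_start k \<le> n" "16 * n \<le> rarity (Suc k)" and y: "\<bar>y\<bar> \<le> 2 * int (width k)"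
  shows "1 / (102 * real (width k) * sqrt (real n / rarity k)) \<le> hit step_law n y"
proof -
  have h: "1 \<le> real (width k)" and Q: "1 \<le> real (rarity k)" using width_pos[of k] rarity_pos[of k] by auto
  define t where "t = sqrt (real n / rarity k)"
  have "rarity k \<le> n" using n(1) width_pos[of k] unfolding scale_start_def
    by (metis le_trans mult_le_mono1 nat_mult_1 one_le_mult_iff one_le_numeral)
  then have t: "1 \<le> t" using Q by (simp add: t_def)
  have ht: "1 \<le> real (width k) * t" using mult_mono[OF h t] by simp
  have tt: "t\<^sup>2 = real n / rarity k" by (simp add: t_def)
  define R where "R = nat \<lceil>16 * real (width k) * t\<rceil>"
  have R: "16 * real (width k) * t \<le> R" "R \<le> 17 * real (width k) * t" "R \<ge> 1"
  proof -
    have "0 \<le> \<lceil>16 * real (width k) * t\<rceil>" using ht by linarith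
    then have "real R = real_of_int \<lceil>16 * real (width k) * t\<rceil>" by (simp add: R_def)
    then have *: "16 * (real (width k) * t) \<le> real R" "real R \<le> 16 * (real (width k) * t) + 1"
      using ceiling_correct[of "16 * real (width k) * t"] by (simp_all add: mult.assoc)
    then show "16 * real (width k) * t \<le> real R" "real R \<le> 17 * real (width k) * t" "1 \<le> R"
      using ht unfolding mult.assoc by linarith+
  qed
  let ?w = "avg step_law (\<lambda>x. min ((real_of_int x)\<^sup>2) ((real R)\<^sup>2)) 0"
  have "n * ?w \<le> n * (32 * (real (width k))\<^sup>2 / rarity k + (real R)\<^sup>2 / rarity (Suc k))"
    by (intro mult_left_mono truncated_variance_step_law) simp
  also have "\<dots> = (16 * real (width k) * t)\<^sup>2 / 8 + (real R)\<^sup>2 * (real n / rarity (Suc k))"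
    unfolding power_mult_distrib tt by (simp add: field_simps)
  also have "\<dots> \<le> (real R)\<^sup>2 / 8 + (real R)\<^sup>2 * (1 / 16)"
  proof (intro add_mono divide_right_mono mult_left_mono power_mono R)
    have "16 * real n \<le> real (rarity (Suc k))" using of_nat_mono[OF n(2), where 'a = real] by simp
    then show "real n / rarity (Suc k) \<le> 1 / 16" using rarity_pos[of "Suc k"] by (simp add: field_simps)
  qed (use t in auto)
  also have "\<dots> \<le> (real R)\<^sup>2 / 4" by simp
  finally have "1 / (6 * real R) \<le> hit step_law n y"
    using hit_lower[OF symmetric_step_law R(3) unimodal_hit_step_law hit_small[OF n(1)]] y by simp
  moreover have "1 / (102 * real (width k) * t) \<le> 1 / (6 * real R)"
    using R h t by (intro divide_left_mono) (auto simp: mult.commute)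
  ultimately show ?thesis by (simp add: t_def)
qed

subsection \<open>Dyadic harmonic sums\<close>

lemma harmonic_upper: "(\<Sum>l<2 ^ j. 1 / (real l + 1)) \<le> 1 + real j"
proof (induction j)
  case (Suc j)
  have "(\<Sum>l<2 ^ Suc j. 1 / (real l + 1)) = (\<Sum>l<2 ^ j. 1 / (real l + 1)) + (\<Sum>l\<in>{2 ^ j..<2 ^ Suc j}. 1 / (real l + 1))"
    by (subst sum.union_disjoint[symmetric]) (auto intro!: sum.cong)
  also have "(\<Sum>l\<in>{2 ^ j..<2 ^ Suc j}. 1 / (real l + 1)) \<le> (\<Sum>l\<in>{2 ^ j..<(2::nat) ^ Suc j}. 1 / 2 ^ j)"
  proof (intro sum_mono divide_left_mono)
    fix l :: nat assume "l \<in> {2 ^ j..<2 ^ Suc j}"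
    then have "real (2 ^ j) \<le> real l" by (simp only: of_nat_le_iff) auto
    then have "2 ^ j \<le> real l" unfolding of_nat_power of_nat_numeral .
    then show "2 ^ j \<le> real l + 1" by linarith
  qed auto
  also have "\<dots> = 1" by simp
  finally show ?case using Suc by simp
qed simp

lemma harmonic_lower:
  assumes a: "a \<ge> 1"
  shows "real j / 2 \<le> (\<Sum>n\<in>{a..<a * 2 ^ j}. 1 / real n)"
proof (induction j)
  case (Suc j)
  have m: "a \<le> a * 2 ^ j" "a * 2 ^ j \<le> a * 2 ^ Suc j" by auto
  have "1 / 2 = (\<Sum>n\<in>{a * 2 ^ j..<a * 2 ^ Suc j}. 1 / real (a * 2 ^ Suc j))"
    using a by simp
  also have "\<dots> \<le> (\<Sum>n\<in>{a * 2 ^ j..<a * 2 ^ Suc j}. 1 / real n)"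
  proof (intro sum_mono divide_left_mono)
    fix n assume n: "n \<in> {a * 2 ^ j..<a * 2 ^ Suc j}"
    then show "real n \<le> real (a * 2 ^ Suc j)" by (simp only: of_nat_le_iff) auto
    have "0 < n" using n a by (auto intro: gr0I)
    then show "0 < real (a * 2 ^ Suc j) * real n" using a by simp
  qed auto
  finally show ?case
    using Suc sum.atLeastLessThan_concat[OF m, of "\<lambda>n. 1 / real n"] by simp
qed simp

lemma scale_start_power: "scale_start k = 2 ^ (10 + (2 * k + scale_exp k) + scale_exp k)"
  unfolding scale_start_def width_def rarity_def power_add by simp

text \<open>The end of the range of times governed by level \<open>k\<close>. Up to this time a step of a higher level is unlikely.\<close>

definition scale_end :: "nat \<Rightarrow> nat" where "scale_end k = scale_start k * 2 ^ width k"

lemma scale_end_le: "16 * scale_end k \<le> rarity (Suc k)"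
proof -
  have "16 * scale_end k = 2 ^ (4 + (10 + (2 * k + scale_exp k) + scale_exp k) + width k)"
    by (simp add: scale_end_def scale_start_power power_add)
  also have "\<dots> \<le> 2 ^ scale_exp (Suc k)"
    by (rule power_increasing) (use less_width[of k] width_pos[of k] in \<open>auto simp: scale_exp_Suc\<close>)
  finally show ?thesis by (simp add: rarity_def)
qed

lemma harmonic_scale_end: "(\<Sum>l<scale_end k. 1 / (real l + 1)) \<le> 14 * real (width k)"
proof -
  let ?j = "10 + (2 * k + scale_exp k) + scale_exp k + width k"
  have "scale_end k = 2 ^ ?j" by (simp add: scale_end_def scale_start_power power_add)
  with harmonic_upper[of ?j] have "(\<Sum>l<scale_end k. 1 / (real l + 1)) \<le> real (1 + ?j)" by simp
  also have "1 + ?j \<le> 14 * width k" using less_width[of k] width_pos[of k] by linarith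
  finally show ?thesis by simp
qed

lemma harmonic_scale_start_Suc: "(\<Sum>l<scale_start (Suc k). 1 / (real l + 1)) \<le> 46 * real (width k)"
proof -
  let ?j = "10 + (2 * Suc k + scale_exp (Suc k)) + scale_exp (Suc k)"
  have "(\<Sum>l<scale_start (Suc k). 1 / (real l + 1)) \<le> real (1 + ?j)"
    using harmonic_upper[of ?j] by (simp add: scale_start_power)
  also have "1 + ?j \<le> 46 * width k" using less_width[of k] width_pos[of k] by (simp add: scale_exp_Suc)
  finally show ?thesis by simp
qed

subsection \<open>Sums over a scale\<close>

text \<open>Up to the factor \<open>1 / Q\<^sub>k\<close>, this bounds the expected number of crossings by steps of size of order
  \<open>h\<^sub>k\<close> (the event \<open>pivot\<close> below) before the end of the scale, from any starting point. Each summand is at most \<open>4 h\<^sub>k u\<^sup>2 + 2 v\<close> if the return probability is at most \<open>u + v\<close>,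
  with \<open>u\<close> the spread and \<open>v\<close> the probability of no step of level \<open>k\<close>; the minimum with \<open>1\<close> matters
  at early times, where \<open>v\<close> dominates.\<close>

lemma future_sum:
  "(\<Sum>l<scale_end k. hit step_law l 0 * min 1 (real (width k) * hit step_law l 0)) \<le> 32 * real (rarity k)"
proof -
  have h: "1 \<le> real (width k)" using width_pos[of k] by auto
  let ?u = "\<lambda>l. 1 / (real (2 * width k + 1) * sqrt ((real l + 1) * level_prob k))"
  let ?v = "\<lambda>l. (1 - level_prob k) ^ l"
  have "hit step_law l 0 * min 1 (real (width k) * hit step_law l 0) \<le>
      4 * real (width k) * (real (rarity k) / (2 * (real (width k))\<^sup>2) * (1 / (real l + 1))) + 2 * ?v l" for l
  proof -
    let ?a = "hit step_law l 0"
    have a: "0 \<le> ?a" "?a \<le> ?v l + ?u l" using hit_nonneg hit_step_law_upper by auto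
    have v: "0 \<le> ?v l" using level_prob_le1[of k] by simp
    have "?a * min 1 (real (width k) * ?a) \<le> 4 * real (width k) * (?u l)\<^sup>2 + 2 * ?v l"
    proof (cases "?v l \<le> ?u l")
      case True
      then have a2: "?a \<le> 2 * ?u l" using a by linarith
      have "?a * min 1 (real (width k) * ?a) \<le> ?a * (real (width k) * ?a)" using a by (intro mult_left_mono) auto
      also have "\<dots> = real (width k) * ?a\<^sup>2" by (simp add: power2_eq_square)
      also have "\<dots> \<le> real (width k) * (2 * ?u l)\<^sup>2" using a a2 by (intro mult_left_mono power_mono) auto
      finally have "?a * min 1 (real (width k) * ?a) \<le> 4 * real (width k) * (?u l)\<^sup>2"
        unfolding power_mult_distrib by simp
      then show ?thesis using v by linarith
    next
      case False
      have "?a * min 1 (real (width k) * ?a) \<le> ?a * 1" using a by (intro mult_left_mono) auto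
      also have "\<dots> \<le> 2 * ?v l" using a False by linarith
      finally show ?thesis using h by (simp add: add_increasing)
    qed
    also have "\<dots> \<le> 4 * real (width k) * (real (rarity k) / (2 * (real (width k))\<^sup>2) * (1 / (real l + 1))) + 2 * ?v l"
      using h by (intro add_mono mult_left_mono spread_upper) auto
    finally show ?thesis .
  qed
  then have "(\<Sum>l<scale_end k. hit step_law l 0 * min 1 (real (width k) * hit step_law l 0)) \<le>
      (\<Sum>l<scale_end k. 4 * real (width k) * (real (rarity k) / (2 * (real (width k))\<^sup>2) * (1 / (real l + 1))) + 2 * ?v l)"
    by (intro sum_mono)
  also have "\<dots> = 4 * real (width k) * (real (rarity k) / (2 * (real (width k))\<^sup>2)) * (\<Sum>l<scale_end k. 1 / (real l + 1)) + 2 * (\<Sum>l<scale_end k. ?v l)"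
    by (simp only: sum.distrib sum_distrib_left mult.assoc)
  also have "\<dots> \<le> 4 * real (width k) * (real (rarity k) / (2 * (real (width k))\<^sup>2)) * (14 * real (width k)) + 2 * (2 * real (rarity k))"
    by (intro add_mono mult_left_mono harmonic_scale_end geom_sum) auto
  also have "\<dots> = 32 * real (rarity k)" using h by (simp add: power2_eq_square field_simps)
  finally show ?thesis .
qed

text \<open>The contribution of one scale to the Green function of the two-dimensional walk.\<close>

lemma hit_square_sum:
  "(\<Sum>n\<in>{scale_start k..<scale_start (Suc k)}. (hit step_law n 0)\<^sup>2) \<le> 48 * (1 / 4) ^ k"
proof -
  have h: "1 \<le> real (width k)" and Q: "1 \<le> real (rarity k)" using width_pos[of k] rarity_pos[of k] by auto
  have hQ: "real (rarity k) / real (width k) = (1 / 4) ^ k" using Q by (simp add: width_eq power_divide)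
  let ?I = "{scale_start k..<scale_start (Suc k)}"
  let ?u = "\<lambda>l. 1 / (real (2 * width k + 1) * sqrt ((real l + 1) * level_prob k))"
  let ?v = "\<lambda>l. (1 - level_prob k) ^ l"
  have "(hit step_law n 0)\<^sup>2 \<le> 2 * (real (rarity k) / (2 * (real (width k))\<^sup>2) * (1 / (real n + 1))) + 2 * (1 / (512 * real (width k)) * ?v n)"
    if n: "n \<in> ?I" for n
  proof -
    have v: "0 \<le> ?v n" using level_prob_le1[of k] by simp
    have "(hit step_law n 0)\<^sup>2 \<le> (?v n + ?u n)\<^sup>2"
      by (rule power_mono[OF hit_step_law_upper hit_nonneg])
    also have "\<dots> \<le> 2 * (?u n)\<^sup>2 + 2 * (?v n)\<^sup>2"
      using sum_squares_bound[of "?v n" "?u n"] by (simp add: power2_sum)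
    also have "\<dots> \<le> 2 * (real (rarity k) / (2 * (real (width k))\<^sup>2) * (1 / (real n + 1))) + 2 * (1 / (512 * real (width k)) * ?v n)"
      unfolding power2_eq_square[of "?v n"] using v n scale_start_geom[of k n]
      by (intro add_mono mult_left_mono spread_upper mult_right_mono) auto
    finally show ?thesis .
  qed
  then have "(\<Sum>n\<in>?I. (hit step_law n 0)\<^sup>2) \<le>
      (\<Sum>n\<in>?I. 2 * (real (rarity k) / (2 * (real (width k))\<^sup>2) * (1 / (real n + 1))) + 2 * (1 / (512 * real (width k)) * ?v n))"
    by (intro sum_mono)
  also have "\<dots> \<le> (\<Sum>n<scale_start (Suc k). 2 * (real (rarity k) / (2 * (real (width k))\<^sup>2) * (1 / (real n + 1))) + 2 * (1 / (512 * real (width k)) * ?v n))"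
    using level_prob_le1[of k] by (intro sum_mono2) auto
  also have "\<dots> = 2 * (real (rarity k) / (2 * (real (width k))\<^sup>2)) * (\<Sum>n<scale_start (Suc k). 1 / (real n + 1)) +
      2 * (1 / (512 * real (width k))) * (\<Sum>n<scale_start (Suc k). ?v n)"
    by (simp only: sum.distrib sum_distrib_left mult.assoc)
  also have "\<dots> \<le> 2 * (real (rarity k) / (2 * (real (width k))\<^sup>2)) * (46 * real (width k)) +
      2 * (1 / (512 * real (width k))) * (2 * real (rarity k))"
    by (intro add_mono mult_left_mono harmonic_scale_start_Suc geom_sum) auto
  also have "\<dots> = (46 + 4 / 512) * (real (rarity k) / real (width k))"
    using h by (simp add: power2_eq_square field_simps)
  also have "\<dots> \<le> 48 * (1 / 4) ^ k" unfolding hQ by simp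
  finally show ?thesis .
qed

lemma scale_start_ge: "k \<le> scale_start k"
  using less_width[of k] rarity_pos[of k] unfolding scale_start_def
  by (metis le_add1 le_trans less_imp_le mult_le_mono mult.commute mult_1 one_le_numeral mult_2)

lemma scale_start_mono: "scale_start k \<le> scale_start (Suc k)"
  using width_Suc_ge[of k] rarity_Suc_ge[of k] unfolding scale_start_def by (intro mult_le_mono) auto

lemma summable_hit_square: "summable (\<lambda>n. (hit step_law n 0)\<^sup>2)"
proof (rule summableI_nonneg_bounded)
  fix n
  have part: "(\<Sum>i<scale_start K. (hit step_law i 0)\<^sup>2) \<le> real (scale_start 0) + (\<Sum>k<K. 48 * (1 / 4) ^ k)" for K
  proof (induction K)
    case 0
    have "(\<Sum>i<scale_start 0. (hit step_law i 0)\<^sup>2) \<le> (\<Sum>i<scale_start 0. 1)"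
      by (intro sum_mono power_le_one hit_nonneg hit_le_1)
    then show ?case by simp
  next
    case (Suc K)
    have "(\<Sum>i<scale_start (Suc K). (hit step_law i 0)\<^sup>2) = (\<Sum>i<scale_start K. (hit step_law i 0)\<^sup>2) + (\<Sum>i\<in>{scale_start K..<scale_start (Suc K)}. (hit step_law i 0)\<^sup>2)"
      using sum.atLeastLessThan_concat[OF le0 scale_start_mono[of K], of "\<lambda>i. (hit step_law i 0)\<^sup>2"]
      by (simp add: lessThan_atLeast0)
    then show ?case using Suc hit_square_sum[of K] by simp
  qed
  have "(\<Sum>i<n. (hit step_law i 0)\<^sup>2) \<le> (\<Sum>i<scale_start n. (hit step_law i 0)\<^sup>2)"
    using scale_start_ge[of n] by (intro sum_mono2) auto
  also have "\<dots> \<le> real (scale_start 0) + (\<Sum>k<n. 48 * (1 / 4) ^ k)" by (rule part)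
  also have "(\<Sum>k<n. 48 * (1 / 4) ^ k) = 48 * (\<Sum>k<n. (1 / 4 :: real) ^ k)"
    by (simp add: sum_distrib_left)
  also have "(\<Sum>k<n. (1 / 4 :: real) ^ k) \<le> 4 / 3"
    by (subst sum_gp_strict) simp
  finally show "(\<Sum>i<n. (hit step_law i 0)\<^sup>2) \<le> real (scale_start 0) + 48 * (4 / 3)" by simp
qed auto

section \<open>The space of step sequences\<close>

interpretation step: sequence_space "measure_pmf \<mu>" for \<mu> :: "int pmf"
  by unfold_locales

lemma prob_space_step_space: "prob_space (step_space \<mu>)"
  unfolding step_space_def by (rule step.prob_space_axioms)

interpretation step_space: prob_space "step_space \<mu>" for \<mu>
  by (rule prob_space_step_space)

interpretation step_space_pair: pair_prob_space "step_space \<mu>" "step_space \<mu>" for \<mu> ..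

interpretation step_space2: prob_space "step_space2 \<mu>" for \<mu>
  unfolding step_space2_def by unfold_locales

lemma space_step_space [simp]: "space (step_space \<mu>) = UNIV"
  by (simp add: step_space_def space_PiM)

lemma space_step_space2 [simp]: "space (step_space2 \<mu>) = UNIV"
  by (simp add: step_space2_def space_pair_measure)

lemma measurable_coord [measurable]: "(\<lambda>x. x j) \<in> step_space \<mu> \<rightarrow>\<^sub>M count_space UNIV"
proof -
  have "(\<lambda>x. x j) \<in> step_space \<mu> \<rightarrow>\<^sub>M measure_pmf \<mu>"
    unfolding step_space_def by (rule measurable_component_singleton) simp
  then show ?thesis by simp
qed

lemma measurable_walk [measurable]: "walk n \<in> step_space \<mu> \<rightarrow>\<^sub>M count_space UNIV"
proof (induction n)
  case 0
  then show ?case by (simp add: walk_def)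
next
  case (Suc n)
  have [measurable]: "walk n \<in> step_space \<mu> \<rightarrow>\<^sub>M count_space UNIV" by fact
  have "(\<lambda>x. walk n x + x n) \<in> step_space \<mu> \<rightarrow>\<^sub>M count_space UNIV"
    by (rule measurable_compose_countable[where g = "walk n"]) measurable
  then show ?case by (simp add: walk_def)
qed

lemma measurable_coords2 [measurable]:
  "(\<lambda>z. walk n (fst z)) \<in> step_space2 \<mu> \<rightarrow>\<^sub>M count_space UNIV"
  "(\<lambda>z. walk n (snd z)) \<in> step_space2 \<mu> \<rightarrow>\<^sub>M count_space UNIV"
  "(\<lambda>z. fst z n) \<in> step_space2 \<mu> \<rightarrow>\<^sub>M count_space UNIV"
  "(\<lambda>z. snd z n) \<in> step_space2 \<mu> \<rightarrow>\<^sub>M count_space UNIV"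
  unfolding step_space2_def by measurable

lemma measurable_comb_seq_step:
  assumes "f \<in> N \<rightarrow>\<^sub>M step_space \<mu>" "g \<in> N \<rightarrow>\<^sub>M step_space \<mu>"
  shows "(\<lambda>x. comb_seq t (f x) (g x)) \<in> N \<rightarrow>\<^sub>M step_space \<mu>"
  using assms unfolding step_space_def by (rule measurable_comb_seq')

lemma walk_comb_seq: "walk (t + n) (comb_seq t x x') = walk t x + walk n x'"
proof -
  have "(\<Sum>j<t. comb_seq t x x' j) = (\<Sum>j<t. x j)"
    by (intro sum.cong) (auto simp: comb_seq_less)
  moreover have "(\<Sum>j\<in>{t..<t + n}. comb_seq t x x' j) = (\<Sum>j<n. x' j)"
    by (rule sum.reindex_bij_witness[of _ "\<lambda>j. j + t" "\<lambda>j. j - t"])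
      (auto simp: comb_seq_def)
  ultimately show ?thesis
    unfolding walk_def using sum.atLeastLessThan_concat[of 0 t "t + n" "comb_seq t x x'"]
    by (simp add: lessThan_atLeast0)
qed

lemma walk_comb_seq_le: "n \<le> t \<Longrightarrow> walk n (comb_seq t x x') = walk n x"
  unfolding walk_def by (intro sum.cong) (auto simp: comb_seq_less)

section \<open>The Markov property\<close>

text \<open>The steps before and after time \<open>t\<close> are independent, and the later ones form a copy of the whole sequence.\<close>

lemma nn_integral_comb_seq:
  assumes [measurable]: "f \<in> borel_measurable (step_space \<mu>)"
  shows "(\<integral>\<^sup>+x. f x \<partial>step_space \<mu>) =
    (\<integral>\<^sup>+x. (\<integral>\<^sup>+x'. f (comb_seq t x x') \<partial>step_space \<mu>) \<partial>step_space \<mu>)"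
proof -
  let ?S = "step_space \<mu>"
  have [measurable]: "(\<lambda>(x, x'). comb_seq t x x') \<in> ?S \<Otimes>\<^sub>M ?S \<rightarrow>\<^sub>M ?S"
    unfolding step_space_def by (rule measurable_comb_seq)
  have "(\<integral>\<^sup>+x. f x \<partial>?S) = (\<integral>\<^sup>+x. f x \<partial>distr (?S \<Otimes>\<^sub>M ?S) ?S (\<lambda>(x, x'). comb_seq t x x'))"
    unfolding step_space_def step.PiM_comb_seq ..
  also have "\<dots> = (\<integral>\<^sup>+z. f (case z of (x, x') \<Rightarrow> comb_seq t x x') \<partial>(?S \<Otimes>\<^sub>M ?S))"
    by (rule nn_integral_distr) measurable
  also have "\<dots> = (\<integral>\<^sup>+x. (\<integral>\<^sup>+x'. f (comb_seq t x x') \<partial>?S) \<partial>?S)"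
    by (subst step_space.nn_integral_fst[symmetric]) (auto simp: case_prod_beta')
  finally show ?thesis .
qed

text \<open>Concatenation at time \<open>t\<close> in both components.\<close>

definition comb_seq2 :: "nat \<Rightarrow> (nat \<Rightarrow> int) \<times> (nat \<Rightarrow> int) \<Rightarrow> (nat \<Rightarrow> int) \<times> (nat \<Rightarrow> int) \<Rightarrow> (nat \<Rightarrow> int) \<times> (nat \<Rightarrow> int)" where
  "comb_seq2 t z z' = (comb_seq t (fst z) (fst z'), comb_seq t (snd z) (snd z'))"

lemma nn_integral_comb_seq2:
  assumes f: "f \<in> borel_measurable (step_space2 \<mu>)"
  shows "(\<integral>\<^sup>+z. f z \<partial>step_space2 \<mu>) =
    (\<integral>\<^sup>+z. (\<integral>\<^sup>+z'. f (comb_seq2 t z z') \<partial>step_space2 \<mu>) \<partial>step_space2 \<mu>)"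
proof -
  let ?S = "step_space \<mu>"
  have [measurable]: "f \<in> borel_measurable (?S \<Otimes>\<^sub>M ?S)"
    using f by (simp add: step_space2_def)
  note [measurable] = measurable_comb_seq_step
  have "(\<integral>\<^sup>+z. f z \<partial>step_space2 \<mu>) = (\<integral>\<^sup>+x. \<integral>\<^sup>+y. f (x, y) \<partial>?S \<partial>?S)"
    unfolding step_space2_def by (rule step_space.nn_integral_fst[symmetric]) measurable
  also have "\<dots> = (\<integral>\<^sup>+x. \<integral>\<^sup>+x'. \<integral>\<^sup>+y. f (comb_seq t x x', y) \<partial>?S \<partial>?S \<partial>?S)"
    by (rule nn_integral_comb_seq) measurable
  also have "\<dots> = (\<integral>\<^sup>+x. \<integral>\<^sup>+x'. \<integral>\<^sup>+y. \<integral>\<^sup>+y'. f (comb_seq t x x', comb_seq t y y') \<partial>?S \<partial>?S \<partial>?S \<partial>?S)"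
    by (intro nn_integral_cong nn_integral_comb_seq) measurable
  also have "\<dots> = (\<integral>\<^sup>+x. \<integral>\<^sup>+y. \<integral>\<^sup>+x'. \<integral>\<^sup>+y'. f (comb_seq t x x', comb_seq t y y') \<partial>?S \<partial>?S \<partial>?S \<partial>?S)"
    by (intro nn_integral_cong step_space_pair.Fubini') measurable
  also have "\<dots> = (\<integral>\<^sup>+x. \<integral>\<^sup>+y. \<integral>\<^sup>+z'. f (comb_seq2 t (x, y) z') \<partial>(?S \<Otimes>\<^sub>M ?S) \<partial>?S \<partial>?S)"
    unfolding comb_seq2_def by (subst step_space.nn_integral_fst[symmetric]) (auto, measurable)
  also have "\<dots> = (\<integral>\<^sup>+z. \<integral>\<^sup>+z'. f (comb_seq2 t z z') \<partial>(?S \<Otimes>\<^sub>M ?S) \<partial>(?S \<Otimes>\<^sub>M ?S))"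
    unfolding comb_seq2_def by (subst (2) step_space.nn_integral_fst[symmetric]) (auto, measurable)
  finally show ?thesis by (simp add: step_space2_def)
qed

text \<open>The form in which the Markov property at time \<open>t\<close> is used: \<open>A\<close> concerns the past, and \<open>R z\<close> the future
  given the past \<open>z\<close>.\<close>

lemma markov_bound:
  assumes Q [measurable]: "Measurable.pred (step_space2 \<mu>) Q"
    and A [measurable]: "Measurable.pred (step_space2 \<mu>) A"
    and R [measurable]: "\<And>z. Measurable.pred (step_space2 \<mu>) (R z)"
    and QR: "\<And>z z'. Q (comb_seq2 t z z') \<Longrightarrow> A z \<and> R z z'"
    and c: "\<And>z. A z \<Longrightarrow> measure (step_space2 \<mu>) {z'. R z z'} \<le> c" "0 \<le> c"
  shows "measure (step_space2 \<mu>) {z. Q z} \<le> c * measure (step_space2 \<mu>) {z. A z}"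
proof -
  let ?Z = "step_space2 \<mu>"
  have mQ: "{z. Q z} \<in> sets ?Z" "{z. A z} \<in> sets ?Z" "{z'. R z z'} \<in> sets ?Z" for z
    using predE[OF Q] predE[OF A] predE[OF R] by simp_all
  have "emeasure ?Z {z. Q z} = (\<integral>\<^sup>+z. indicator {z. Q z} z \<partial>?Z)"
    using mQ by simp
  also have "\<dots> = (\<integral>\<^sup>+z. \<integral>\<^sup>+z'. indicator {z. Q z} (comb_seq2 t z z') \<partial>?Z \<partial>?Z)"
    using mQ by (intro nn_integral_comb_seq2) simp
  also have "\<dots> \<le> (\<integral>\<^sup>+z. ennreal c * indicator {z. A z} z \<partial>?Z)"
  proof (rule nn_integral_mono)
    fix z
    show "(\<integral>\<^sup>+z'. indicator {z. Q z} (comb_seq2 t z z') \<partial>?Z) \<le> ennreal c * indicator {z. A z} z"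
    proof (cases "A z")
      case True
      have "(\<integral>\<^sup>+z'. indicator {z. Q z} (comb_seq2 t z z') \<partial>?Z) \<le> (\<integral>\<^sup>+z'. indicator {z'. R z z'} z' \<partial>?Z)"
        using QR by (intro nn_integral_mono) (auto simp: indicator_def)
      also have "\<dots> = emeasure ?Z {z'. R z z'}" using mQ by simp
      also have "\<dots> \<le> ennreal c"
        unfolding step_space2.emeasure_eq_measure by (rule ennreal_leI[OF c(1)[OF True]])
      finally show ?thesis using True by simp
    next
      case False
      then have "indicator {z. Q z} (comb_seq2 t z z') = (0 :: ennreal)" for z'
        using QR[of z z'] by (auto simp: indicator_def)
      then show ?thesis by simp
    qed
  qed
  also have "\<dots> = ennreal c * emeasure ?Z {z. A z}"
    using mQ by (simp add: nn_integral_cmult)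
  finally show ?thesis
    using c(2) by (simp add: step_space2.emeasure_eq_measure flip: ennreal_mult)
qed

lemma sets_walk:
  "{x. walk n x \<in> A} \<in> sets (step_space \<mu>)"
  "{x. x n \<in> B} \<in> sets (step_space \<mu>)"
  "{x. walk n x \<in> A \<and> x n \<in> B} \<in> sets (step_space \<mu>)"
  "{x. z + walk n x = 0} \<in> sets (step_space \<mu>)"
proof -
  show 1: "{x. walk n x \<in> A} \<in> sets (step_space \<mu>)" for A
    using measurable_sets[OF measurable_walk, of A n \<mu>] by (simp add: vimage_def)
  show 2: "{x. x n \<in> B} \<in> sets (step_space \<mu>)"
    using measurable_sets[OF measurable_coord, of B n \<mu>] by (simp add: vimage_def)
  show "{x. walk n x \<in> A \<and> x n \<in> B} \<in> sets (step_space \<mu>)"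
    using sets.Int[OF 1 2] by (simp add: Int_def)
  have "{x. z + walk n x = 0} = {x. walk n x \<in> {- z}}" by auto
  then show "{x. z + walk n x = 0} \<in> sets (step_space \<mu>)" using 1 by metis
qed

text \<open>By induction on the time, conditioning on the first step.\<close>

lemma prob_walk: "measure (step_space \<mu>) {x. z + walk n x = 0} = hit \<mu> n z"
proof (induction n arbitrary: z)
  case 0
  then show ?case using step_space.prob_space by (auto simp: walk_def)
next
  case (Suc n)
  let ?S = "step_space \<mu>"
  have m: "(\<lambda>(s, x). case_nat s x) \<in> measure_pmf \<mu> \<Otimes>\<^sub>M ?S \<rightarrow>\<^sub>M ?S"
    unfolding step_space_def by measurable
  have w: "walk (Suc n) (case_nat s x) = s + walk n x" for s x
    unfolding walk_def by (simp add: sum.lessThan_Suc_shift del: sum.lessThan_Suc)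
  let ?A = "{x. z + walk (Suc n) x = 0}"
  have A: "?A \<in> sets ?S" by (rule sets_walk)
  have "emeasure ?S ?A = emeasure (distr (measure_pmf \<mu> \<Otimes>\<^sub>M ?S) ?S (\<lambda>(s, x). case_nat s x)) ?A"
    unfolding step_space_def step.PiM_iter ..
  also have "\<dots> = emeasure (measure_pmf \<mu> \<Otimes>\<^sub>M ?S) ((\<lambda>(s, x). case_nat s x) -` ?A \<inter> space (measure_pmf \<mu> \<Otimes>\<^sub>M ?S))"
    by (rule emeasure_distr[OF m A])
  also have "\<dots> = (\<integral>\<^sup>+s. emeasure ?S (Pair s -` ((\<lambda>(s, x). case_nat s x) -` ?A \<inter> space (measure_pmf \<mu> \<Otimes>\<^sub>M ?S))) \<partial>measure_pmf \<mu>)"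
    by (rule step_space.emeasure_pair_measure_alt) (rule measurable_sets[OF m A])
  also have "\<dots> = (\<integral>\<^sup>+s. ennreal (hit \<mu> n (z + s)) \<partial>measure_pmf \<mu>)"
  proof (rule nn_integral_cong)
    fix s
    have "Pair s -` ((\<lambda>(s, x). case_nat s x) -` ?A \<inter> space (measure_pmf \<mu> \<Otimes>\<^sub>M ?S)) = {x. (z + s) + walk n x = 0}"
      by (auto simp: space_pair_measure w add.assoc)
    then show "emeasure ?S (Pair s -` ((\<lambda>(s, x). case_nat s x) -` ?A \<inter> space (measure_pmf \<mu> \<Otimes>\<^sub>M ?S))) = ennreal (hit \<mu> n (z + s))"
      using Suc[of "z + s"] by (simp add: step_space.emeasure_eq_measure)
  qed
  also have "\<dots> = ennreal (avg \<mu> (hit \<mu> n) z)"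
    unfolding avg_def[of \<mu> "hit \<mu> n"] using hit_nonneg
    by (intro nn_integral_eq_integral avg_integrable[OF bounded_by_hit]) auto
  finally show ?case
    using hit_nonneg[where \<mu> = \<mu> and n = "Suc n" and x = z] by (simp add: step_space.emeasure_eq_measure)
qed

lemma prob_walk_set:
  assumes "finite A"
  shows "measure (step_space \<mu>) {x. walk n x \<in> A} = (\<Sum>a\<in>A. hit \<mu> n (- a))"
proof -
  have "{x. walk n x \<in> A} = (\<Union>a\<in>A. {x. - a + walk n x = 0})" by auto
  also have "measure (step_space \<mu>) \<dots> = (\<Sum>a\<in>A. measure (step_space \<mu>) {x. - a + walk n x = 0})"
    using assms
    by (intro step_space.finite_measure_finite_Union)
      (auto simp only: disjoint_family_on_def image_subset_iff intro!: sets_walk)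
  finally show ?thesis unfolding prob_walk .
qed

lemma prob_step: "measure (step_space \<mu>) {x. x n \<in> B} = measure_pmf.prob \<mu> B"
proof -
  have "emeasure (distr (step_space \<mu>) (measure_pmf \<mu>) (\<lambda>x. x n)) B = emeasure (measure_pmf \<mu>) B"
    unfolding step_space_def by (subst step.PiM_component) auto
  also have "emeasure (distr (step_space \<mu>) (measure_pmf \<mu>) (\<lambda>x. x n)) B = emeasure (step_space \<mu>) {x. x n \<in> B}"
    by (subst emeasure_distr) (auto simp: vimage_def)
  finally show ?thesis by (simp add: measure_def)
qed

lemma prob_walk_step:
  "measure (step_space \<mu>) {x. walk n x \<in> A \<and> x n \<in> B} =
    measure (step_space \<mu>) {x. walk n x \<in> A} * measure_pmf.prob \<mu> B"
proof -
  let ?S = "step_space \<mu>"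
  have c: "comb_seq n x x' n = x' 0" for x x' :: "nat \<Rightarrow> int" by (simp add: comb_seq_def)
  have "emeasure ?S {x. walk n x \<in> A \<and> x n \<in> B} = (\<integral>\<^sup>+x. indicator {x. walk n x \<in> A \<and> x n \<in> B} x \<partial>?S)"
    by (rule nn_integral_indicator[symmetric]) (rule sets_walk)
  also have "\<dots> = (\<integral>\<^sup>+x. \<integral>\<^sup>+x'. indicator {x. walk n x \<in> A \<and> x n \<in> B} (comb_seq n x x') \<partial>?S \<partial>?S)"
    by (rule nn_integral_comb_seq) (rule borel_measurable_indicator[OF sets_walk(3)])
  also have "\<dots> = (\<integral>\<^sup>+x. \<integral>\<^sup>+x'. indicator {x. walk n x \<in> A} x * indicator {x. x 0 \<in> B} x' \<partial>?S \<partial>?S)"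
    by (intro nn_integral_cong) (auto simp: indicator_def walk_comb_seq_le c)
  also have "\<dots> = (\<integral>\<^sup>+x. indicator {x. walk n x \<in> A} x * emeasure ?S {x. x 0 \<in> B} \<partial>?S)"
    by (simp add: nn_integral_cmult sets_walk)
  also have "\<dots> = emeasure ?S {x. walk n x \<in> A} * emeasure ?S {x. x 0 \<in> B}"
    by (simp add: nn_integral_multc sets_walk)
  finally show ?thesis
    by (simp add: step_space.emeasure_eq_measure prob_step flip: ennreal_mult)
qed

lemma prob_times:
  assumes "{x. P x} \<in> sets (step_space \<mu>)" "{y. Q y} \<in> sets (step_space \<mu>)"
  shows "measure (step_space2 \<mu>) {z. P (fst z) \<and> Q (snd z)} =
    measure (step_space \<mu>) {x. P x} * measure (step_space \<mu>) {y. Q y}"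
proof -
  have "{z. P (fst z) \<and> Q (snd z)} = {x. P x} \<times> {y. Q y}" by auto
  then show ?thesis unfolding step_space2_def
    using assms by (simp add: measure_def step_space.emeasure_pair_measure_Times enn2real_mult)
qed

section \<open>A second moment bound\<close>

text \<open>With \<open>X\<close> the number of events that occur, \<open>2 c X - c\<^sup>2 X\<^sup>2\<close> is at most the indicator of \<open>X \<noteq> 0\<close>; taking
  expectations with \<open>c = 1 / (1 + 2 \<beta>)\<close> gives the bound.\<close>

lemma (in prob_space) second_moment_union:
  fixes I :: "nat set"
  assumes I: "finite I" and E: "\<And>n. n \<in> I \<Longrightarrow> E n \<in> events" and \<beta>: "0 \<le> \<beta>"
    and pair: "\<And>n. n \<in> I \<Longrightarrow> (\<Sum>n'\<in>{n' \<in> I. n < n'}. prob (E n \<inter> E n')) \<le> \<beta> * prob (E n)"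
  shows "(\<Sum>n\<in>I. prob (E n)) / (1 + 2 * \<beta>) \<le> prob (\<Union>n\<in>I. E n)"
proof -
  let ?X = "\<lambda>x. \<Sum>n\<in>I. indicator (E n) x :: real"
  let ?m = "\<Sum>n\<in>I. prob (E n)"
  define c where "c = 1 / (1 + 2 * \<beta>)"
  have c: "0 < c" "c * (1 + 2 * \<beta>) = 1" using \<beta> by (auto simp: c_def)
  have U: "(\<Union>n\<in>I. E n) \<in> events" using I E by auto
  have X2: "?X x * ?X x = (\<Sum>n\<in>I. \<Sum>n'\<in>I. indicator (E n \<inter> E n') x)" for x
    by (simp add: sum_product indicator_inter_arith)
  have iE: "integrable M (indicator (E n) :: _ \<Rightarrow> real)" if "n \<in> I" for n
    using E[OF that] by (simp add: integrable_indicator_iff less_top[symmetric])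
  have iEE: "integrable M (indicator (E n \<inter> E n') :: _ \<Rightarrow> real)" if "n \<in> I" "n' \<in> I" for n n'
    using E that by (simp add: integrable_indicator_iff less_top[symmetric] sets.Int)
  have i: "integrable M ?X" "integrable M (\<lambda>x. ?X x * ?X x)"
    unfolding X2 using iE iEE by (auto intro!: Bochner_Integration.integrable_sum)
  have eX: "expectation ?X = ?m" using iE E by (simp add: Bochner_Integration.integral_sum)
  have "expectation (\<lambda>x. ?X x * ?X x) = (\<Sum>n\<in>I. \<Sum>n'\<in>I. prob (E n \<inter> E n'))"
    unfolding X2 using iEE E by (simp add: Bochner_Integration.integral_sum sets.Int)
  also have "\<dots> = (\<Sum>n\<in>I. \<Sum>n'\<in>I. (if n' = n then prob (E n) else 0) +
      ((if n < n' then prob (E n \<inter> E n') else 0) + (if n' < n then prob (E n' \<inter> E n) else 0)))"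
    by (intro sum.cong refl) (auto simp: Int_commute)
  also have "\<dots> = (\<Sum>n\<in>I. \<Sum>n'\<in>I. if n' = n then prob (E n) else 0) +
      ((\<Sum>n\<in>I. \<Sum>n'\<in>I. if n < n' then prob (E n \<inter> E n') else 0) +
       (\<Sum>n\<in>I. \<Sum>n'\<in>I. if n' < n then prob (E n' \<inter> E n) else 0))"
    by (simp only: sum.distrib)
  also have "(\<Sum>n\<in>I. \<Sum>n'\<in>I. if n' < n then prob (E n' \<inter> E n) else 0) =
      (\<Sum>n\<in>I. \<Sum>n'\<in>I. if n < n' then prob (E n \<inter> E n') else 0)"
    by (rule sum.swap)
  also have "(\<Sum>n\<in>I. \<Sum>n'\<in>I. if n' = n then prob (E n) else 0) = ?m"
    using I by simp
  also have "(\<Sum>n\<in>I. \<Sum>n'\<in>I. if n < n' then prob (E n \<inter> E n') else 0) =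
      (\<Sum>n\<in>I. \<Sum>n'\<in>{n' \<in> I. n < n'}. prob (E n \<inter> E n'))"
    using I by (simp add: sum.inter_filter)
  also have "\<dots> \<le> (\<Sum>n\<in>I. \<beta> * prob (E n))" by (intro sum_mono pair)
  finally have X2m: "expectation (\<lambda>x. ?X x * ?X x) \<le> (1 + 2 * \<beta>) * ?m"
    by (simp add: sum_distrib_left[symmetric] algebra_simps)
  have "c * ?m = 2 * c * ?m - c * c * ((1 + 2 * \<beta>) * ?m)"
  proof -
    have "c * c * ((1 + 2 * \<beta>) * ?m) = c * (c * (1 + 2 * \<beta>)) * ?m" by (simp only: mult_ac)
    then show ?thesis unfolding c(2) by simp
  qed
  also have "\<dots> \<le> 2 * c * expectation ?X - c * c * expectation (\<lambda>x. ?X x * ?X x)"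
    using X2m c(1) unfolding eX by (intro diff_mono mult_left_mono) auto
  also have "\<dots> = expectation (\<lambda>x. 2 * c * ?X x - c * c * (?X x * ?X x))"
    using i by simp
  also have "\<dots> \<le> expectation (indicator (\<Union>n\<in>I. E n))"
  proof (rule integral_mono)
    show "2 * c * ?X x - c * c * (?X x * ?X x) \<le> indicator (\<Union>n\<in>I. E n) x" for x
    proof (cases "x \<in> (\<Union>n\<in>I. E n)")
      case True
      have "0 \<le> (1 - c * ?X x)\<^sup>2" by simp
      then show ?thesis using True by (simp add: power2_eq_square algebra_simps)
    next
      case False
      then have "?X x = 0" by (intro sum.neutral) auto
      then show ?thesis using False by simp
    qed
  qed (use i U in \<open>auto simp: integrable_indicator_iff less_top[symmetric]\<close>)
  also have "\<dots> = prob (\<Union>n\<in>I. E n)" using U by simp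
  finally show ?thesis by (simp add: c_def)
qed

section \<open>Crossings within a scale\<close>

lemma pred_count:
  assumes "f \<in> M \<rightarrow>\<^sub>M count_space UNIV"
  shows "Measurable.pred M (\<lambda>z. P (f z))"
  by (rule measurable_compose[OF assms]) simp

lemma pred_count2:
  fixes f :: "'a \<Rightarrow> int"
  assumes f: "f \<in> M \<rightarrow>\<^sub>M count_space UNIV" and g: "g \<in> M \<rightarrow>\<^sub>M count_space UNIV"
  shows "Measurable.pred M (\<lambda>z. P (f z) (g z))"
  by (rule measurable_compose_countable[OF _ f]) (rule pred_count[OF g])

text \<open>The event \<open>V\<^sub>n\<close> for the pair of walks started at \<open>(s, t)\<close>.\<close>

definition crossing :: "int \<Rightarrow> int \<Rightarrow> nat \<Rightarrow> (nat \<Rightarrow> int) \<times> (nat \<Rightarrow> int) \<Rightarrow> bool" where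
  "crossing s t n z \<longleftrightarrow> sgn (s + walk n (fst z)) = - sgn (s + walk (Suc n) (fst z)) \<and>
     t + walk n (snd z) = 0 \<and> t + walk (Suc n) (snd z) = 0"

text \<open>A special way in which a crossing may occur for the walks started at \<open>(s, t)\<close>, whose probability is easily
  bounded from both sides: the first walk is in \<open>{1..h\<^sub>k}\<close> and makes a step to the left of size between \<open>h\<^sub>k + 1\<close> and
  \<open>4 h\<^sub>k\<close>, while the second walk is at the origin and makes a zero step.\<close>

definition pivot :: "nat \<Rightarrow> int \<Rightarrow> int \<Rightarrow> nat \<Rightarrow> (nat \<Rightarrow> int) \<times> (nat \<Rightarrow> int) \<Rightarrow> bool" where
  "pivot k s t n z \<longleftrightarrow>
     (walk n (fst z) \<in> {1 - s..int (width k) - s} \<and> fst z n \<in> {- 4 * int (width k)..- int (width k) - 1}) \<and>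
     (walk n (snd z) \<in> {- t} \<and> snd z n \<in> {0})"

lemma pred_crossing: "Measurable.pred (step_space2 \<mu>) (crossing s t n)"
  unfolding crossing_def
  by (intro pred_intros_logic pred_count2[OF measurable_coords2(1) measurable_coords2(1)]
      pred_count[OF measurable_coords2(2)])

lemma pred_crossing_before: "Measurable.pred (step_space2 \<mu>) (\<lambda>z. \<exists>n<b. crossing s t n z)"
  by (intro pred_intros_countable pred_intros_conj1' pred_crossing)

lemma pred_pivot: "Measurable.pred (step_space2 \<mu>) (pivot k s t n)"
  unfolding pivot_def
  by (intro pred_intros_logic pred_count[OF measurable_coords2(1)] pred_count[OF measurable_coords2(2)]
      pred_count[OF measurable_coords2(3)] pred_count[OF measurable_coords2(4)])

lemma sets2: "Measurable.pred (step_space2 \<mu>) P \<Longrightarrow> {z. P z} \<in> sets (step_space2 \<mu>)"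
  by (drule predE) simp

lemma walk_Suc: "walk (Suc n) x = walk n x + x n"
  by (simp add: walk_def)

lemma pivot_crossing: "pivot k s t n z \<Longrightarrow> crossing s t n z"
  by (auto simp: pivot_def crossing_def walk_Suc sgn_if)

lemma prob_pivot:
  "measure (step_space2 step_law) {z. pivot k s t n z} =
    (\<Sum>a\<in>{1 - s..int (width k) - s}. hit step_law n (- a)) *
      measure_pmf.prob step_law {- 4 * int (width k)..- int (width k) - 1} * (hit step_law n t * pmf step_law 0)"
proof -
  have "measure (step_space2 step_law) {z. pivot k s t n z} =
      measure (step_space step_law) {x. walk n x \<in> {1 - s..int (width k) - s} \<and> x n \<in> {- 4 * int (width k)..- int (width k) - 1}} *
      measure (step_space step_law) {x. walk n x \<in> {- t} \<and> x n \<in> {0}}"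
    unfolding pivot_def by (rule prob_times[OF sets_walk(3) sets_walk(3)])
  then show ?thesis
    unfolding prob_walk_step prob_walk_set[OF finite_atLeastAtMost_int]
      prob_walk_set[OF finite.insertI[OF finite.emptyI]] by (simp add: measure_pmf_single)
qed

lemma hit_le_hit0: "hit step_law n x \<le> hit step_law n 0"
  by (rule unimodalD[OF unimodal_hit_step_law]) simp

lemma prob_pivot_upper:
  "measure (step_space2 step_law) {z. pivot k s t n z} \<le>
    hit step_law n 0 * min 1 (real (width k) * hit step_law n 0) / real (rarity k)"
proof -
  let ?A = "{1 - s..int (width k) - s}" and ?B = "{- 4 * int (width k)..- int (width k) - 1}"
  have "(\<Sum>a\<in>?A. hit step_law n (- a)) \<le> (\<Sum>a\<in>?A. hit step_law n 0)"
    by (intro sum_mono hit_le_hit0)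
  moreover have "(\<Sum>a\<in>?A. hit step_law n (- a)) \<le> 1"
    unfolding prob_walk_set[OF finite_atLeastAtMost_int, symmetric] by (rule step_space.prob_le_1)
  ultimately have 1: "(\<Sum>a\<in>?A. hit step_law n (- a)) \<le> min 1 (real (width k) * hit step_law n 0)" by simp
  have "measure_pmf.prob step_law ?B \<le> measure_pmf.prob step_law {y. int (width k) < \<bar>y\<bar>}"
    by (intro measure_pmf.finite_measure_mono) auto
  then have 2: "measure_pmf.prob step_law ?B \<le> 1 / real (rarity k)" using step_law_big_step[of k] by linarith
  have 3: "hit step_law n t * pmf step_law 0 \<le> hit step_law n 0 * 1"
    by (intro mult_mono hit_le_hit0 pmf_le_1 hit_nonneg) auto
  have "measure (step_space2 step_law) {z. pivot k s t n z} \<le>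
      min 1 (real (width k) * hit step_law n 0) * (1 / real (rarity k)) * (hit step_law n 0 * 1)"
    unfolding prob_pivot
    by (intro mult_mono 1 2 3) (auto simp: hit_nonneg intro!: mult_nonneg_nonneg sum_nonneg)
  then show ?thesis by (simp add: mult_ac)
qed

lemma prob_pivot_lower:
  assumes s: "\<bar>s\<bar> \<le> int (width k)" and t: "\<bar>t\<bar> \<le> int (width k)" and n: "n \<in> {scale_start k..<scale_end k}"
  shows "1 / (998784 * real (width k)) * (1 / real n) \<le> measure (step_space2 step_law) {z. pivot k s t n z}"
proof -
  have h: "1 \<le> real (width k)" and Q: "1 \<le> real (rarity k)" using width_pos[of k] rarity_pos[of k] by auto
  have "1 \<le> scale_start k" using width_pos[of k] rarity_pos[of k] by (simp add: scale_start_def)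
  then have n1: "1 \<le> real n" using n by simp
  let ?A = "{1 - s..int (width k) - s}" and ?B = "{- 4 * int (width k)..- int (width k) - 1}"
  define L where "L = 1 / (102 * real (width k) * sqrt (real n / rarity k))"
  have L0: "0 \<le> L" by (simp add: L_def)
  have n': "scale_start k \<le> n" "16 * n \<le> rarity (Suc k)" using n scale_end_le[of k] by auto
  have L: "L \<le> hit step_law n y" if "\<bar>y\<bar> \<le> 2 * int (width k)" for y
    unfolding L_def by (rule hit_step_law_lower[OF n' that])
  have "(\<Sum>a\<in>?A. L) \<le> (\<Sum>a\<in>?A. hit step_law n (- a))"
    using s by (intro sum_mono L) auto
  then have 1: "real (width k) * L \<le> (\<Sum>a\<in>?A. hit step_law n (- a))" by simp
  have 2: "1 / (8 * real (rarity k)) \<le> measure_pmf.prob step_law ?B"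
    using level_prob_ge[of k] step_law_crossing_step[of k] by simp
  have 3: "L * (1 / 12) \<le> hit step_law n t * pmf step_law 0"
    using t L0 by (intro mult_mono L step_law_zero hit_nonneg) auto
  have "1 / (998784 * real (width k)) * (1 / real n) = real (width k) * L * (1 / (8 * real (rarity k))) * (L * (1 / 12))"
  proof -
    have "L * L = real (rarity k) / (10404 * (real (width k))\<^sup>2 * real n)"
    proof -
      have "L * L = 1 / (10404 * (real (width k))\<^sup>2 * (sqrt (real n / rarity k))\<^sup>2)"
        unfolding L_def power2_eq_square by (simp del: real_sqrt_mult_self)
      then show ?thesis by simp
    qed
    moreover have "real (width k) * L * (1 / (8 * real (rarity k))) * (L * (1 / 12)) =
        real (width k) * (L * L) * (1 / (96 * real (rarity k)))" by simp
    ultimately have "real (width k) * L * (1 / (8 * real (rarity k))) * (L * (1 / 12)) =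
        real (width k) * (real (rarity k) / (10404 * (real (width k))\<^sup>2 * real n)) * (1 / (96 * real (rarity k)))"
      by (simp only:)
    also have "\<dots> = 1 / (998784 * real (width k)) * (1 / real n)"
      using h Q n1 by (simp add: power2_eq_square)
    finally show ?thesis ..
  qed
  also have "\<dots> \<le> measure (step_space2 step_law) {z. pivot k s t n z}"
    unfolding prob_pivot
    by (intro mult_mono 1 2 3) (use L0 Q in \<open>auto simp: hit_nonneg intro!: mult_nonneg_nonneg sum_nonneg\<close>)
  finally show ?thesis .
qed

lemma comb_seq_later: "comb_seq t x x' (t + l) = x' l"
  by (simp add: comb_seq_def)

text \<open>Given a pivot at time \<open>n\<close>, a second one at time \<open>n'\<close> is a pivot of the restarted walks at time \<open>n' - n - 1\<close>.\<close>

lemma prob_pivot_pair: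
  assumes "n < n'"
  shows "measure (step_space2 step_law) ({z. pivot k s t n z} \<inter> {z. pivot k s t n' z}) \<le>
    hit step_law (n' - n - 1) 0 * min 1 (real (width k) * hit step_law (n' - n - 1) 0) / real (rarity k) *
      measure (step_space2 step_law) {z. pivot k s t n z}"
proof -
  define l where "l = n' - n - 1"
  have n': "n' = Suc n + l" using assms by (simp add: l_def)
  have "measure (step_space2 step_law) {z. pivot k s t n z \<and> pivot k s t n' z} \<le>
    hit step_law l 0 * min 1 (real (width k) * hit step_law l 0) / real (rarity k) * measure (step_space2 step_law) {z. pivot k s t n z}"
  proof (rule markov_bound[where t = "Suc n" and
        R = "\<lambda>z. pivot k (s + walk (Suc n) (fst z)) (t + walk (Suc n) (snd z)) l"])
    fix z z' assume "pivot k s t n (comb_seq2 (Suc n) z z') \<and> pivot k s t n' (comb_seq2 (Suc n) z z')"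
    then show "pivot k s t n z \<and> pivot k (s + walk (Suc n) (fst z)) (t + walk (Suc n) (snd z)) l z'"
      unfolding n' pivot_def comb_seq2_def fst_conv snd_conv walk_comb_seq comb_seq_later
      by (auto simp: walk_comb_seq_le comb_seq_less)
  qed (auto intro!: pred_intros_logic pred_pivot prob_pivot_upper simp: hit_nonneg)
  then show ?thesis by (simp add: l_def Int_def)
qed

text \<open>A lower bound, not optimised, for the probability of a crossing before the end of a scale. The expected
  number of pivots in the scale is at least \<open>1 / 1997568\<close>, and the second moment bound with \<open>\<beta> = 32\<close> divides it by \<open>65\<close>.\<close>

definition cross_const :: real where "cross_const = 1 / 130000000"

lemma prob_crossing_block:
  assumes s: "\<bar>s\<bar> \<le> int (width k)" and t: "\<bar>t\<bar> \<le> int (width k)"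
  shows "cross_const \<le> measure (step_space2 step_law) {z. \<exists>n<scale_end k. crossing s t n z}"
proof -
  let ?Z = "step_space2 step_law" and ?I = "{scale_start k..<scale_end k}"
  let ?E = "\<lambda>n. {z. pivot k s t n z}"
  have h: "1 \<le> real (width k)" and Q: "1 \<le> real (rarity k)" using width_pos[of k] rarity_pos[of k] by auto
  have E: "?E n \<in> sets ?Z" for n by (rule sets2[OF pred_pivot])
  have "1 \<le> scale_start k" using width_pos[of k] rarity_pos[of k] by (simp add: scale_start_def)
  then have "real (width k) / 2 \<le> (\<Sum>n\<in>?I. 1 / real n)"
    unfolding scale_end_def by (rule harmonic_lower)
  then have "1 / (998784 * real (width k)) * (real (width k) / 2) \<le> 1 / (998784 * real (width k)) * (\<Sum>n\<in>?I. 1 / real n)"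
    by (rule mult_left_mono) simp
  also have "\<dots> = (\<Sum>n\<in>?I. 1 / (998784 * real (width k)) * (1 / real n))"
    by (rule sum_distrib_left)
  also have "\<dots> \<le> (\<Sum>n\<in>?I. measure ?Z (?E n))"
    by (intro sum_mono prob_pivot_lower s t)
  finally have EN: "1 / 1997568 \<le> (\<Sum>n\<in>?I. measure ?Z (?E n))" using h by simp
  have "(\<Sum>n\<in>?I. measure ?Z (?E n)) / (1 + 2 * 32) \<le> measure ?Z (\<Union>n\<in>?I. ?E n)"
  proof (rule step_space2.second_moment_union)
    fix n assume n: "n \<in> ?I"
    let ?g = "\<lambda>l. hit step_law l 0 * min 1 (real (width k) * hit step_law l 0)"
    let ?J = "{n' \<in> ?I. n < n'}"
    have g: "0 \<le> ?g l" for l by (simp add: hit_nonneg)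
    have inj: "inj_on (\<lambda>n'. n' - n - 1) ?J" by (rule inj_onI) auto
    have "(\<Sum>n'\<in>?J. measure ?Z (?E n \<inter> ?E n')) \<le>
        (\<Sum>n'\<in>?J. ?g (n' - n - 1) * (measure ?Z (?E n) / real (rarity k)))"
      using prob_pivot_pair[of n _ k s t] by (intro sum_mono) (simp add: mult_ac)
    also have "\<dots> = (\<Sum>l\<in>(\<lambda>n'. n' - n - 1) ` ?J. ?g l) * (measure ?Z (?E n) / real (rarity k))"
      unfolding sum_distrib_right[symmetric] sum.reindex[OF inj] by simp
    also have "\<dots> \<le> (\<Sum>l<scale_end k. ?g l) * (measure ?Z (?E n) / real (rarity k))"
      by (intro mult_right_mono sum_mono2) (auto simp: hit_nonneg)
    also have "\<dots> \<le> (32 * real (rarity k)) * (measure ?Z (?E n) / real (rarity k))"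
      by (intro mult_right_mono future_sum) auto
    finally show "(\<Sum>n'\<in>?J. measure ?Z (?E n \<inter> ?E n')) \<le> 32 * measure ?Z (?E n)" using Q by simp
  qed (use E in auto)
  also have "\<dots> \<le> measure ?Z {z. \<exists>n<scale_end k. crossing s t n z}"
  proof (rule step_space2.finite_measure_mono)
    show "(\<Union>n\<in>?I. ?E n) \<subseteq> {z. \<exists>n<scale_end k. crossing s t n z}" by (auto dest: pivot_crossing)
    show "{z. \<exists>n<scale_end k. crossing s t n z} \<in> sets ?Z"
      by (rule sets2[OF pred_crossing_before])
  qed
  finally have "(\<Sum>n\<in>?I. measure ?Z (?E n)) / (1 + 2 * 32) \<le> measure ?Z {z. \<exists>n<scale_end k. crossing s t n z}" .
  moreover have "1 / 1997568 / (1 + 2 * 32) \<le> (\<Sum>n\<in>?I. measure ?Z (?E n)) / (1 + 2 * 32)"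
    by (rule divide_right_mono[OF EN]) simp
  moreover have "cross_const \<le> 1 / 1997568 / (1 + 2 * 32)" by (simp add: cross_const_def)
  ultimately show ?thesis by linarith
qed

section \<open>Infinitely many crossings\<close>

text \<open>The probability that no crossing ever occurs for the walks started at \<open>(s, t)\<close>.\<close>

abbreviation never :: "int \<Rightarrow> int \<Rightarrow> real" where
  "never s t \<equiv> measure (step_space2 step_law) {z. \<forall>n. \<not> crossing s t n z}"

lemma pred_never: "Measurable.pred (step_space2 \<mu>) (\<lambda>z. \<forall>n. \<not> crossing s t n z)"
  by (intro pred_intros_countable pred_intros_logic pred_crossing)

lemma crossing_comb_seq2_later:
  "crossing s t (T + n) (comb_seq2 T z z') \<longleftrightarrow>
    crossing (s + walk T (fst z)) (t + walk T (snd z)) n z'"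
  unfolding crossing_def comb_seq2_def fst_conv snd_conv add_Suc_right[symmetric] walk_comb_seq
  by (simp add: add.assoc)

lemma crossing_comb_seq2_earlier:
  "n < T \<Longrightarrow> crossing s t n (comb_seq2 T z z') \<longleftrightarrow> crossing s t n z"
  unfolding crossing_def comb_seq2_def fst_conv snd_conv by (simp add: walk_comb_seq_le)

text \<open>Choose a scale whose width exceeds the distance of the starting point from the origin, and apply the Markov
  property at its end.\<close>

lemma never_step:
  assumes H: "\<And>s t. never s t \<le> H" "0 \<le> H"
  shows "never s t \<le> H * (1 - cross_const)"
proof -
  let ?Z = "step_space2 step_law"
  define k where "k = nat (max \<bar>s\<bar> \<bar>t\<bar>)"
  have st: "\<bar>s\<bar> \<le> int (width k)" "\<bar>t\<bar> \<le> int (width k)"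
    using less_width[of k] unfolding k_def by linarith+
  have p: "Measurable.pred ?Z (\<lambda>z. \<exists>n<scale_end k. crossing s t n z)"
    by (rule pred_crossing_before)
  have "never s t \<le> H * measure ?Z {z. \<not> (\<exists>n<scale_end k. crossing s t n z)}"
  proof (rule markov_bound[where t = "scale_end k" and
        R = "\<lambda>z z'. \<forall>n. \<not> crossing (s + walk (scale_end k) (fst z)) (t + walk (scale_end k) (snd z)) n z'"])
    fix z z' assume a: "\<forall>n. \<not> crossing s t n (comb_seq2 (scale_end k) z z')"
    from a show "\<not> (\<exists>n<scale_end k. crossing s t n z) \<and>
        (\<forall>n. \<not> crossing (s + walk (scale_end k) (fst z)) (t + walk (scale_end k) (snd z)) n z')"
      using a crossing_comb_seq2_earlier[of _ "scale_end k" s t z z'] crossing_comb_seq2_later[of s t "scale_end k" _ z z'] by blast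
  next
    show "Measurable.pred ?Z (\<lambda>z. \<forall>n. \<not> crossing s t n z)" by (rule pred_never)
    show "Measurable.pred ?Z (\<lambda>z. \<not> (\<exists>n<scale_end k. crossing s t n z))" by (rule pred_intros_logic(2)[OF p])
    show "Measurable.pred ?Z (\<lambda>z'. \<forall>n. \<not> crossing (s + walk (scale_end k) (fst z)) (t + walk (scale_end k) (snd z)) n z')" for z
      by (rule pred_never)
    show "never (s + walk (scale_end k) (fst z)) (t + walk (scale_end k) (snd z)) \<le> H" for z by (rule H(1))
  qed (rule H(2))
  also have "measure ?Z {z. \<not> (\<exists>n<scale_end k. crossing s t n z)} = 1 - measure ?Z {z. \<exists>n<scale_end k. crossing s t n z}"
  proof -
    have "{z. \<not> (\<exists>n<scale_end k. crossing s t n z)} = space ?Z - {z. \<exists>n<scale_end k. crossing s t n z}" by auto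
    then show ?thesis by (simp only: step_space2.prob_compl[OF sets2[OF p]])
  qed
  also have "H * \<dots> \<le> H * (1 - cross_const)"
    using prob_crossing_block[OF st] H(2) by (intro mult_left_mono) auto
  finally show ?thesis .
qed

lemma never_zero: "never s t = 0"
proof -
  define H where "H = (SUP (s, t). never s t)"
  have bdd: "bdd_above (range (\<lambda>(s, t). never s t))"
    by (rule bdd_aboveI[of _ 1]) auto
  have le: "never s t \<le> H" for s t
    unfolding H_def using cSUP_upper[OF UNIV_I bdd, of "(s, t)"] by simp
  have H0: "0 \<le> H" using order_trans[OF measure_nonneg le[of 0 0]] .
  have "H \<le> H * (1 - cross_const)"
    unfolding H_def using never_step[OF le H0, unfolded H_def] by (intro cSUP_least) auto
  then have "H * cross_const \<le> 0" by (simp add: algebra_simps)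
  then have "H \<le> 0" by (simp add: cross_const_def)
  then show ?thesis using le[of s t] measure_nonneg[of "step_space2 step_law"] by (intro antisym) (rule order_trans, auto)
qed

lemma AE_crossing_infinite: "AE z in step_space2 step_law. infinite {n. crossing 0 0 n z}"
proof -
  let ?Z = "step_space2 step_law"
  have "AE z in ?Z. \<exists>n. crossing 0 0 (T + n) z" for T
  proof -
    have p: "Measurable.pred ?Z (\<lambda>z. \<forall>n. \<not> crossing 0 0 (T + n) z)"
      by (intro pred_intros_countable pred_intros_logic pred_crossing)
    have "measure ?Z {z. \<forall>n. \<not> crossing 0 0 (T + n) z} \<le> 0 * measure ?Z {z. True}"
    proof (rule markov_bound[where t = T and
          R = "\<lambda>z z'. \<forall>n. \<not> crossing (walk T (fst z)) (walk T (snd z)) n z'"])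
      fix z z' assume "\<forall>n. \<not> crossing 0 0 (T + n) (comb_seq2 T z z')"
      then show "True \<and> (\<forall>n. \<not> crossing (walk T (fst z)) (walk T (snd z)) n z')"
        by (simp add: crossing_comb_seq2_later)
    next
      show "Measurable.pred ?Z (\<lambda>z. \<forall>n. \<not> crossing 0 0 (T + n) z)" by (rule p)
      show "Measurable.pred ?Z (\<lambda>z'. \<forall>n. \<not> crossing (walk T (fst z)) (walk T (snd z)) n z')" for z
        by (rule pred_never)
      show "never (walk T (fst z)) (walk T (snd z)) \<le> 0" for z by (simp only: never_zero)
    qed auto
    then have "emeasure ?Z {z. \<forall>n. \<not> crossing 0 0 (T + n) z} = 0"
      by (simp add: step_space2.emeasure_eq_measure measure_le_0_iff)
    then have "{z. \<forall>n. \<not> crossing 0 0 (T + n) z} \<in> null_sets ?Z"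
      using sets2[OF p] by (simp add: null_sets_def)
    from AE_not_in[OF this] show ?thesis by simp
  qed
  then have "AE z in ?Z. \<forall>T. \<exists>n. crossing 0 0 (T + n) z" by (simp add: AE_all_countable)
  then show ?thesis
  proof eventually_elim
    case (elim z)
    then show ?case unfolding infinite_nat_iff_unbounded_le by (metis le_add1 mem_Collect_eq)
  qed
qed

section \<open>Transience\<close>

lemma measurable_pairs:
  "{z. walk n (fst z) = 0 \<and> walk n (snd z) = 0} \<in> sets (step_space2 \<mu>)"
  "{z. walk n (fst z) * walk (Suc n) (fst z) < 0 \<and> walk n (snd z) = 0} \<in> sets (step_space2 \<mu>)"
  by (intro sets2 pred_intros_logic pred_count[OF measurable_coords2(1)] pred_count[OF measurable_coords2(2)]
      pred_count2[OF measurable_coords2(1) measurable_coords2(1)])+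

lemma AE_finite_of_summable:
  assumes A: "\<And>n. {z. P n z} \<in> sets (step_space2 \<mu>)" and s: "summable (\<lambda>n. measure (step_space2 \<mu>) {z. P n z})"
  shows "AE z in step_space2 \<mu>. finite {n. P n z}"
proof -
  have "AE z in step_space2 \<mu>. eventually (\<lambda>n. z \<in> space (step_space2 \<mu>) - {z. P n z}) sequentially"
    by (rule borel_cantelli_AE1[OF A _ s]) (simp add: less_top[symmetric])
  then show ?thesis
  proof eventually_elim
    case (elim z)
    then obtain N where "\<And>n. n \<ge> N \<Longrightarrow> \<not> P n z" by (auto simp: eventually_sequentially)
    then have "{n. P n z} \<subseteq> {..<N}" by (auto simp: not_le[symmetric])
    then show ?case by (rule finite_subset) simp
  qed
qed

lemma prob_return: "measure (step_space \<mu>) {x. walk n x = 0} = hit \<mu> n 0"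
  using prob_walk[of \<mu> 0 n] by simp

lemma sets_return: "{x. walk n x = 0} \<in> sets (step_space \<mu>)"
  using sets_walk(1)[of n "{0}"] by simp

lemma AE_origin_finite: "AE z in step_space2 step_law. finite {n. walk n (fst z) = 0 \<and> walk n (snd z) = 0}"
proof (rule AE_finite_of_summable[OF measurable_pairs(1)])
  show "summable (\<lambda>n. measure (step_space2 step_law) {z. walk n (fst z) = 0 \<and> walk n (snd z) = 0})"
    unfolding prob_times[OF sets_return sets_return] prob_return
    using summable_hit_square by (simp add: power2_eq_square)
qed

text \<open>The event \<open>V\<^sub>n\<close> is contained in the union of a strict sign change over a zero of the other walk and of a visit to
  the origin; the visit is needed because \<open>sgn 0 = - sgn 0\<close>.\<close>

lemma not_summable_sign_changes:
  "\<not> summable (\<lambda>n. hit step_law n 0 * measure (step_space step_law) {x. walk n x * walk (Suc n) x < 0})"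
proof
  assume s: "summable (\<lambda>n. hit step_law n 0 * measure (step_space step_law) {x. walk n x * walk (Suc n) x < 0})"
  have m: "{x. walk n x * walk (Suc n) x < 0} \<in> sets (step_space step_law)" for n
    using predE[OF pred_count2[OF measurable_walk[of n step_law] measurable_walk[of "Suc n" step_law], of "\<lambda>a b. a * b < 0"]]
    by simp
  have "AE z in step_space2 step_law. finite {n. walk n (fst z) * walk (Suc n) (fst z) < 0 \<and> walk n (snd z) = 0}"
  proof (rule AE_finite_of_summable[OF measurable_pairs(2)])
    show "summable (\<lambda>n. measure (step_space2 step_law) {z. walk n (fst z) * walk (Suc n) (fst z) < 0 \<and> walk n (snd z) = 0})"
      unfolding prob_times[OF m sets_return] prob_return using s by (simp only: mult.commute)
  qed
  with AE_origin_finite AE_crossing_infinite have "AE z in step_space2 step_law. False"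
  proof eventually_elim
    case (elim z)
    have "{n. crossing 0 0 n z} \<subseteq> {n. walk n (fst z) = 0 \<and> walk n (snd z) = 0} \<union>
        {n. walk n (fst z) * walk (Suc n) (fst z) < 0 \<and> walk n (snd z) = 0}"
      by (auto simp: crossing_def sgn_if mult_less_0_iff split: if_splits)
    then show ?case using elim finite_subset by blast
  qed
  then show False by simp
qed

theorem theorem3:
  "\<exists>\<mu> :: int pmf. symmetric_pmf \<mu> \<and>
     transient (step_space2 \<mu>) (\<lambda>n (x, y). (walk n x, walk n y)) \<and>
     (AE (x, y) in step_space2 \<mu>.
        infinite {n. sgn (walk n x) = - sgn (walk (Suc n) x) \<and>
                     walk n y = 0 \<and> walk (Suc n) y = 0}) \<and>
     summable (\<lambda>n. \<P>(x in step_space \<mu>. walk (Suc n) x = 0)\<^sup>2) \<and>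
     \<not> summable (\<lambda>n. \<P>(x in step_space \<mu>. walk (Suc n) x = 0) *
                       \<P>(x in step_space \<mu>. walk (Suc n) x * walk (Suc (Suc n)) x < 0))"
proof (intro exI[of _ step_law] conjI)
  show "symmetric_pmf step_law" by (rule symmetric_step_law)
  show "transient (step_space2 step_law) (\<lambda>n (x, y). (walk n x, walk n y))"
    unfolding transient_def using AE_origin_finite by (simp add: case_prod_beta' zero_prod_def)
  show "AE (x, y) in step_space2 step_law. infinite {n. sgn (walk n x) = - sgn (walk (Suc n) x) \<and>
      walk n y = 0 \<and> walk (Suc n) y = 0}"
    using AE_crossing_infinite by (simp add: crossing_def case_prod_beta')
  show "summable (\<lambda>n. \<P>(x in step_space step_law. walk (Suc n) x = 0)\<^sup>2)"
    using summable_ignore_initial_segment[OF summable_hit_square, of 1] by (simp add: prob_return)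
  show "\<not> summable (\<lambda>n. \<P>(x in step_space step_law. walk (Suc n) x = 0) *
      \<P>(x in step_space step_law. walk (Suc n) x * walk (Suc (Suc n)) x < 0))"
    using not_summable_sign_changes
      summable_iff_shift[of "\<lambda>n. hit step_law n 0 * measure (step_space step_law) {x. walk n x * walk (Suc n) x < 0}" 1]
    by (simp add: prob_return)
qed

end
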